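(* Let $\underline{C}'$ be a triangulated category. Assume given two classes $\underline{C}'_-$ and $\underline{C}'_+$ of objects of $\underline{C}'$ such that $\underline{C}'_-\subset\underline{C}'_-[1]$, $\underline{C}'_+[1]\subset\underline{C}'_+$, and $\underline{C}'_-\perp\underline{C}'_+[1]$. Let $\underline{C}'_{w'\le 0}$ be the envelope of $\underline{C}'_-$ and $\underline{C}'_{w'\ge 0}$ the envelope of $\underline{C}'_+$. Call a distinguished triangle $X\to M\to Y[1]\to X[1]$ in $\underline{C}'$ a pre-weight decomposition of $M$ (with components $X$ and $Y$) if $X\in\underline{C}'_{w'\le 0}$ and $Y\in\underline{C}'_{w'\ge 0}$. I. The following statements are valid. 1. The class of objects possessing pre-weight decompositions is extension-closed in $\underline{C}'$. Moreover, if $M,N\in\operatorname{Obj}\underline{C}'$ possess pre-weight decompositions, then any extension of $M$ by $N$ in $\underline{C}'$ possesses a pre-weight decomposition whose components are some extensions of the corresponding components of pre-weight decompositions of $M$ and of $N$, respectively. 2. $\underline{C}'_{w'\le 0}\subset\underline{C}'_{w'\le 0}[1]$ and $\underline{C}'_{w'\ge 0}[1]\subset\underline{C}'_{w'\ge 0}$. 3. $\underline{C}'_{w'\le 0}\perp\underline{C}'_{w'\ge 0}[1]$. 4. Let $C'$ be a subclass of $\operatorname{Obj}\underline{C}'$ such that $\underline{C}'$ is the extension-closure of $C'$ and any element of $C'$ possesses a pre-weight decomposition. Then the pair $(\underline{C}'_{w'\le 0},\underline{C}'_{w'\ge 0})$ gives a weight structure $w'$ on $\underline{C}'$. 5. Assume,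 in addition to the assumptions of I.4, that $C'=\bigcup_{i\in\mathbb{Z}}C[i]$ for some $C\subset\operatorname{Obj}\underline{C}'$ and that for any $c\in C$ there exists $i_c\in\mathbb{Z}$ such that $c[i_c]\in\underline{C}'_{w'\ge 0}$ (resp. $c[i_c]\in\underline{C}'_{w'\le 0}$). Then this $w'$ is bounded below (resp. bounded above). II. Suppose that a class $C''\subset\operatorname{Obj}\underline{C}'$ satisfies the following conditions: $\underline{C}'$ is densely generated by $C''$; pre-weight decompositions exist for $c[i]$ whenever $c\in C''$ and $i\in\mathbb{Z}$; and for any $c\in C''$ there exists $i_c\in\mathbb{Z}$ such that $c[i_c]\in\underline{C}'_{w'\ge 0}$. Then the pair $(\underline{C}'_{w'\le 0},\underline{C}'_{w'\ge 0})$ is a weight structure $w'$ on $\underline{C}'$, and $w'$ is bounded below. Moreover, $w'$ is also bounded above if we assume in addition that for any $c\in C''$ there exists $i'_c\in\mathbb{Z}$ such that $c[i'_c]\in\underline{C}'_{w'\le 0}$. III. Assume that $N\in\underline{C}'_{w'\le 0}$ is a retract of some $M\in\operatorname{Obj}\underline{C}'$ and let $X\to M\to Y[1]\to X[1]$ be a pre-weight decomposition of $M$. Then the following statements are valid. 1. $N$ is a retract of $X$. 2. Suppose that $N'\in\underline{C}'_{w'\ge 0}$ is a retract of some $M'\in\operatorname{Obj}\underline{C}'$ and let $A'\to M'[1]\to B'[1]\to A'[1]$ be a pre-weight decomposition of $M'[1]$. Then $N'$ is a retract of $B'$. 3. Let $A\to X[1]\to B[1]\to A[1]$ be a pre-weight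 decomposition of $X[1]$. Then $B\in\underline{C}'_{w'\le 0}\cap\underline{C}'_{w'\ge 0}$. Moreover, if $N$ also belongs to $\underline{C}'_{w'\ge 0}$ then $N$ is a retract of $B$.
   Context: $X$ is a retract of $Y$ if $\operatorname{id}_X$ factors through $Y$. A class of objects is retraction-closed if it contains all retracts of its elements. $D\perp E$ means that there are no non-zero morphisms from any $X\in D$ to any $Y\in E$. A class $D$ of objects of a triangulated category is extension-closed if $0\in D$ and for any distinguished triangle $A\to E\to C$ with $A,C\in D$ we have $E\in D$. The extension-closure of a class is the smallest extension-closed class containing it (or the corresponding full subcategory); the envelope of a class is the smallest class containing it that is both extension-closed and retraction-closed. An extension of $M$ by $N$ is an object $E$ fitting into a distinguished triangle $N\to E\to M\to N[1]$. A class $D$ densely generates $\underline{C}'$ if $\underline{C}'$ is the smallest retraction-closed full triangulated subcategory of $\underline{C}'$ containing $D$ (equivalently, $\operatorname{Obj}\underline{C}'$ is the envelope of $\bigcup_{j\in\mathbb{Z}}D[j]$). A weight structure $w$ on a triangulated category $\underline{C}$ is a pair of classes $\underline{C}_{w\le 0},\underline{C}_{w\ge 0}\subset \operatorname{Obj}\underline{C}$ such that: (i) both are retraction-closed in $\underline{C}$; (ii) $\underline{C}_{w\le 0}\subset \underline{C}_{w\le 0}[1]$ and $\underline{C}_{w\ge 0}[1]\subset \underline{C}_{w\ge 0}$; (iii) $\underline{C}_{w\le 0}\perp \underline{C}_{w\ge 0}[1]$; (iv) for every $M\in\operatorname{Obj}\underline{C}$ there is a distinguished triangle $X\to M\to Y\to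 X[1]$ with $X\in \underline{C}_{w\le 0}$ and $Y\in \underline{C}_{w\ge 0}[1]$. It is bounded below (resp. bounded above) if $\operatorname{Obj}\underline{C}=\bigcup_{i\in\mathbb{Z}}\underline{C}_{w\ge 0}[i]$ (resp. $\operatorname{Obj}\underline{C}=\bigcup_{i\in\mathbb{Z}}\underline{C}_{w\le 0}[i]$). *)

theory Defs
  imports "HOL-Algebra.Group"
begin

section \<open>Triangulated categories\<close>

text \<open>
  A record carries the data of a category whose morphism sets are equipped with an addition,
  together with a zero object, a translation functor \<open>[1]\<close> (given by \<open>sh\<close> on objects and \<open>shm\<close>
  on morphisms) and a set of distinguished triangles. A triangle
  \<open>X \<rightarrow> Y \<rightarrow> Z \<rightarrow> X[1]\<close> is recorded by its three morphisms, since these determine the objects.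
  Composition is written in the usual order: \<open>g \<cdot> f\<close> is \<open>f\<close> followed by \<open>g\<close>. Only the values on
  \<open>obj\<close> and \<open>arr\<close> are meaningful. Classes of objects are subsets of \<open>obj\<close>.
\<close>

record ('o, 'm) tricat =
  obj :: "'o set"
  arr :: "'m set"
  src :: "'m \<Rightarrow> 'o"
  tgt :: "'m \<Rightarrow> 'o"
  ident :: "'o \<Rightarrow> 'm"
  comp :: "'m \<Rightarrow> 'm \<Rightarrow> 'm" (infixl "\<cdot>\<index>" 70)
  mzero :: "'o \<Rightarrow> 'o \<Rightarrow> 'm"
  madd :: "'m \<Rightarrow> 'm \<Rightarrow> 'm"
  zobj :: "'o"
  sh :: "'o \<Rightarrow> 'o"
  shm :: "'m \<Rightarrow> 'm"
  dist :: "('m \<times> 'm \<times> 'm) set"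

definition mor :: "('o, 'm) tricat \<Rightarrow> 'o \<Rightarrow> 'o \<Rightarrow> 'm set" where
  "mor C A B = {f \<in> arr C. src C f = A \<and> tgt C f = B}"

definition mor_group :: "('o, 'm) tricat \<Rightarrow> 'o \<Rightarrow> 'o \<Rightarrow> 'm monoid" where
  "mor_group C A B = \<lparr>carrier = mor C A B, monoid.mult = madd C, monoid.one = mzero C A B\<rparr>"

definition mneg :: "('o, 'm) tricat \<Rightarrow> 'm \<Rightarrow> 'm" where
  "mneg C f = m_inv (mor_group C (src C f) (tgt C f)) f"

definition is_iso :: "('o, 'm) tricat \<Rightarrow> 'o \<Rightarrow> 'o \<Rightarrow> 'm \<Rightarrow> bool" where
  "is_iso C A B f \<longleftrightarrow> f \<in> mor C A B \<and>
     (\<exists>g \<in> mor C B A. g \<cdot>\<^bsub>C\<^esub> f = ident C A \<and> f \<cdot>\<^bsub>C\<^esub> g = ident C B)"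

definition triangle ::
  "('o, 'm) tricat \<Rightarrow> 'o \<Rightarrow> 'o \<Rightarrow> 'o \<Rightarrow> 'm \<Rightarrow> 'm \<Rightarrow> 'm \<Rightarrow> bool" where
  "triangle C X Y Z f g h \<longleftrightarrow> f \<in> mor C X Y \<and> g \<in> mor C Y Z \<and> h \<in> mor C Z (sh C X)"

definition dtriangle ::
  "('o, 'm) tricat \<Rightarrow> 'o \<Rightarrow> 'o \<Rightarrow> 'o \<Rightarrow> 'm \<Rightarrow> 'm \<Rightarrow> 'm \<Rightarrow> bool" where
  "dtriangle C X Y Z f g h \<longleftrightarrow> triangle C X Y Z f g h \<and> (f, g, h) \<in> dist C"

locale cat =
  fixes C :: "('o, 'm) tricat" (structure)
  assumes src_obj: "f \<in> arr C \<Longrightarrow> src C f \<in> obj C"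
    and tgt_obj: "f \<in> arr C \<Longrightarrow> tgt C f \<in> obj C"
    and ident_mor: "A \<in> obj C \<Longrightarrow> ident C A \<in> mor C A A"
    and comp_mor: "\<lbrakk>f \<in> mor C A B; g \<in> mor C B D\<rbrakk> \<Longrightarrow> g \<cdot> f \<in> mor C A D"
    and comp_ident: "f \<in> mor C A B \<Longrightarrow> f \<cdot> ident C A = f"
    and ident_comp: "f \<in> mor C A B \<Longrightarrow> ident C B \<cdot> f = f"
    and comp_assoc: "\<lbrakk>f \<in> mor C A B; g \<in> mor C B D; h \<in> mor C D E\<rbrakk>
      \<Longrightarrow> (h \<cdot> g) \<cdot> f = h \<cdot> (g \<cdot> f)"

locale additive_cat = cat +
  assumes mor_comm_group: "\<lbrakk>A \<in> obj C; B \<in> obj C\<rbrakk> \<Longrightarrow> comm_group (mor_group C A B)"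
    and comp_madd: "\<lbrakk>f \<in> mor C A B; f' \<in> mor C A B; g \<in> mor C B D\<rbrakk>
      \<Longrightarrow> g \<cdot> madd C f f' = madd C (g \<cdot> f) (g \<cdot> f')"
    and madd_comp: "\<lbrakk>f \<in> mor C A B; g \<in> mor C B D; g' \<in> mor C B D\<rbrakk>
      \<Longrightarrow> madd C g g' \<cdot> f = madd C (g \<cdot> f) (g' \<cdot> f)"
    and zobj_obj: "zobj C \<in> obj C"
    and zobj_initial: "A \<in> obj C \<Longrightarrow> mor C (zobj C) A = {mzero C (zobj C) A}"
    and zobj_terminal: "A \<in> obj C \<Longrightarrow> mor C A (zobj C) = {mzero C A (zobj C)}"
    and biproduct: "\<lbrakk>A \<in> obj C; B \<in> obj C\<rbrakk> \<Longrightarrow>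
      \<exists>S \<in> obj C. \<exists>i \<in> mor C A S. \<exists>j \<in> mor C B S. \<exists>p \<in> mor C S A. \<exists>q \<in> mor C S B.
        p \<cdot> i = ident C A \<and> q \<cdot> j = ident C B \<and>
        p \<cdot> j = mzero C B A \<and> q \<cdot> i = mzero C A B \<and>
        madd C (i \<cdot> p) (j \<cdot> q) = ident C S"

text \<open>The translation is an automorphism (not merely an autoequivalence) of the category, so that
  \<open>X[n]\<close> is an object defined on the nose for every integer \<open>n\<close>.\<close>

locale triangulated_cat = additive_cat +
  assumes shm_mor: "f \<in> mor C A B \<Longrightarrow> shm C f \<in> mor C (sh C A) (sh C B)"
    and shm_ident: "A \<in> obj C \<Longrightarrow> shm C (ident C A) = ident C (sh C A)"
    and shm_comp: "\<lbrakk>f \<in> mor C A B; g \<in> mor C B D\<rbrakk> \<Longrightarrow> shm C (g \<cdot> f) = shm C g \<cdot> shm C f"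
    and shm_madd: "\<lbrakk>f \<in> mor C A B; g \<in> mor C A B\<rbrakk>
      \<Longrightarrow> shm C (madd C f g) = madd C (shm C f) (shm C g)"
    and sh_bij: "bij_betw (sh C) (obj C) (obj C)"
    and shm_bij: "bij_betw (shm C) (arr C) (arr C)"
    and dist_triangle: "(f, g, h) \<in> dist C \<Longrightarrow> \<exists>X Y Z. triangle C X Y Z f g h"
    and TR1_iso: "\<lbrakk>dtriangle C X Y Z f g h; triangle C X' Y' Z' f' g' h';
        is_iso C X X' u; is_iso C Y Y' v; is_iso C Z Z' w;
        v \<cdot> f = f' \<cdot> u; w \<cdot> g = g' \<cdot> v; shm C u \<cdot> h = h' \<cdot> w\<rbrakk>
      \<Longrightarrow> dtriangle C X' Y' Z' f' g' h'"
    and TR1_ident: "A \<in> obj C \<Longrightarrow>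
      dtriangle C A A (zobj C) (ident C A) (mzero C A (zobj C)) (mzero C (zobj C) (sh C A))"
    and TR1_cone: "f \<in> mor C X Y \<Longrightarrow> \<exists>Z g h. dtriangle C X Y Z f g h"
    and TR2: "triangle C X Y Z f g h \<Longrightarrow>
      dtriangle C X Y Z f g h \<longleftrightarrow> dtriangle C Y Z (sh C X) g h (mneg C (shm C f))"
    and TR3: "\<lbrakk>dtriangle C X Y Z f g h; dtriangle C X' Y' Z' f' g' h';
        u \<in> mor C X X'; v \<in> mor C Y Y'; v \<cdot> f = f' \<cdot> u\<rbrakk>
      \<Longrightarrow> \<exists>w \<in> mor C Z Z'. w \<cdot> g = g' \<cdot> v \<and> shm C u \<cdot> h = h' \<cdot> w"
    and TR4: "\<lbrakk>dtriangle C X Y Z' f f1 f2; dtriangle C Y Z X' g g1 g2;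
        dtriangle C X Z Y' (g \<cdot> f) k1 k2\<rbrakk>
      \<Longrightarrow> \<exists>u \<in> mor C Z' Y'. \<exists>v \<in> mor C Y' X'.
            dtriangle C Z' Y' X' u v (shm C f1 \<cdot> g2) \<and>
            u \<cdot> f1 = k1 \<cdot> g \<and> k2 \<cdot> u = f2 \<and> v \<cdot> k1 = g1 \<and> g2 \<cdot> v = shm C f \<cdot> k2"

definition shift :: "('o, 'm) tricat \<Rightarrow> int \<Rightarrow> 'o \<Rightarrow> 'o" where
  "shift C n X = (if 0 \<le> n then (sh C ^^ nat n) X
                  else (the_inv_into (obj C) (sh C) ^^ nat (- n)) X)"

section \<open>Classes of objects\<close>

definition retract_of :: "('o, 'm) tricat \<Rightarrow> 'o \<Rightarrow> 'o \<Rightarrow> bool" where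
  "retract_of C X Y \<longleftrightarrow> X \<in> obj C \<and> Y \<in> obj C \<and>
     (\<exists>i \<in> mor C X Y. \<exists>p \<in> mor C Y X. p \<cdot>\<^bsub>C\<^esub> i = ident C X)"

definition retraction_closed :: "('o, 'm) tricat \<Rightarrow> 'o set \<Rightarrow> bool" where
  "retraction_closed C D \<longleftrightarrow> (\<forall>Y \<in> D. \<forall>X. retract_of C X Y \<longrightarrow> X \<in> D)"

definition orthogonal :: "('o, 'm) tricat \<Rightarrow> 'o set \<Rightarrow> 'o set \<Rightarrow> bool" where
  "orthogonal C D E \<longleftrightarrow> (\<forall>X \<in> D. \<forall>Y \<in> E. \<forall>f \<in> mor C X Y. f = mzero C X Y)"

text \<open>\<open>extension_of C E M N\<close>: \<open>E\<close> is an extension of \<open>M\<close> by \<open>N\<close>, via \<open>N \<rightarrow> E \<rightarrow> M \<rightarrow> N[1]\<close>.\<close>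

definition extension_of :: "('o, 'm) tricat \<Rightarrow> 'o \<Rightarrow> 'o \<Rightarrow> 'o \<Rightarrow> bool" where
  "extension_of C E M N \<longleftrightarrow> (\<exists>f g h. dtriangle C N E M f g h)"

definition extension_closed :: "('o, 'm) tricat \<Rightarrow> 'o set \<Rightarrow> bool" where
  "extension_closed C D \<longleftrightarrow> zobj C \<in> D \<and>
     (\<forall>A E B f g h. dtriangle C A E B f g h \<and> A \<in> D \<and> B \<in> D \<longrightarrow> E \<in> D)"

definition extension_closure :: "('o, 'm) tricat \<Rightarrow> 'o set \<Rightarrow> 'o set" where
  "extension_closure C D = \<Inter> {E. D \<subseteq> E \<and> E \<subseteq> obj C \<and> extension_closed C E}"

definition envelope :: "('o, 'm) tricat \<Rightarrow> 'o set \<Rightarrow> 'o set" where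
  "envelope C D =
     \<Inter> {E. D \<subseteq> E \<and> E \<subseteq> obj C \<and> extension_closed C E \<and> retraction_closed C E}"

text \<open>Object classes of (strictly) full triangulated subcategories. Strictness is harmless below:
  retraction-closed classes are closed under isomorphisms.\<close>

definition triangulated_subclass :: "('o, 'm) tricat \<Rightarrow> 'o set \<Rightarrow> bool" where
  "triangulated_subclass C T \<longleftrightarrow> T \<subseteq> obj C \<and> zobj C \<in> T \<and> sh C ` T = T \<and>
     (\<forall>X Y Z f g h. dtriangle C X Y Z f g h \<and> X \<in> T \<and> Y \<in> T \<longrightarrow> Z \<in> T)"

definition densely_generated_by :: "('o, 'm) tricat \<Rightarrow> 'o set \<Rightarrow> bool" where
  "densely_generated_by C D \<longleftrightarrow> D \<subseteq> obj C \<and>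
     obj C = \<Inter> {T. D \<subseteq> T \<and> triangulated_subclass C T \<and> retraction_closed C T}"

section \<open>Weight structures\<close>

text \<open>\<open>L\<close> and \<open>R\<close> stand for the classes of objects of weights \<open>\<le> 0\<close> and \<open>\<ge> 0\<close>, respectively.\<close>

definition weight_structure :: "('o, 'm) tricat \<Rightarrow> 'o set \<Rightarrow> 'o set \<Rightarrow> bool" where
  "weight_structure C L R \<longleftrightarrow> L \<subseteq> obj C \<and> R \<subseteq> obj C \<and>
     retraction_closed C L \<and> retraction_closed C R \<and>
     L \<subseteq> shift C 1 ` L \<and> shift C 1 ` R \<subseteq> R \<and>
     orthogonal C L (shift C 1 ` R) \<and>
     (\<forall>M \<in> obj C. \<exists>X Y f g h. dtriangle C X M Y f g h \<and> X \<in> L \<and> Y \<in> shift C 1 ` R)"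

definition bounded_below :: "('o, 'm) tricat \<Rightarrow> 'o set \<Rightarrow> 'o set \<Rightarrow> bool" where
  "bounded_below C L R \<longleftrightarrow> obj C = (\<Union>i. shift C i ` R)"

definition bounded_above :: "('o, 'm) tricat \<Rightarrow> 'o set \<Rightarrow> 'o set \<Rightarrow> bool" where
  "bounded_above C L R \<longleftrightarrow> obj C = (\<Union>i. shift C i ` L)"

text \<open>\<open>(f, g, h)\<close> is a pre-weight decomposition \<open>X \<rightarrow> M \<rightarrow> Y[1] \<rightarrow> X[1]\<close> of \<open>M\<close> with respect to
  the generating classes \<open>Cm\<close> and \<open>Cp\<close>.\<close>

definition pre_weight_decomp ::
  "('o, 'm) tricat \<Rightarrow> 'o set \<Rightarrow> 'o set \<Rightarrow> 'o \<Rightarrow> 'o \<Rightarrow> 'o \<Rightarrow> 'm \<Rightarrow> 'm \<Rightarrow> 'm \<Rightarrow> bool" where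
  "pre_weight_decomp C Cm Cp M X Y f g h \<longleftrightarrow>
     dtriangle C X M (shift C 1 Y) f g h \<and> X \<in> envelope C Cm \<and> Y \<in> envelope C Cp"

definition has_pre_weight_decomp ::
  "('o, 'm) tricat \<Rightarrow> 'o set \<Rightarrow> 'o set \<Rightarrow> 'o \<Rightarrow> bool" where
  "has_pre_weight_decomp C Cm Cp M \<longleftrightarrow> (\<exists>X Y f g h. pre_weight_decomp C Cm Cp M X Y f g h)"

end

theory Submission
  imports Defs
begin

text \<open>
  Minimality of envelopes gives I.2 and I.3, because orthogonals and shifts of closed classes are
  closed. For I.1, let \<open>N \<rightarrow> E \<rightarrow> M\<close> be distinguished and decompose \<open>M\<close> and \<open>N\<close>: the composite
  \<open>X\<^sub>M \<rightarrow> M \<rightarrow> N[1] \<rightarrow> Y\<^sub>N[2]\<close> vanishes by orthogonality, so \<open>X\<^sub>M \<rightarrow> N[1]\<close> factors through \<open>X\<^sub>N[1]\<close>,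
  and three octahedra yield the decomposition of \<open>E\<close>. Part III is lifting along the triangles.

  For II, every \<open>M\<close> is a retract of some \<open>N\<close> in the extension-closure \<open>T\<close> of the shifts of \<open>C''\<close>.
  The complement \<open>M'\<close> of \<open>M\<close> in \<open>N\<close> is again a retract of \<open>N\<close>, so splicing the triangles
  \<open>N \<rightarrow> M \<rightarrow> M'[1]\<close> and \<open>N \<rightarrow> M' \<rightarrow> M[1]\<close> produces \<open>S \<rightarrow> M \<rightarrow> K\<close> with \<open>S \<in> T\<close> and \<open>K\<close> of arbitrarily
  large weight, as \<open>N\<close> is bounded below. Since \<open>S\<close> has a decomposition \<open>X \<rightarrow> S \<rightarrow> Y[1]\<close>, the
  octahedron on \<open>X \<rightarrow> S \<rightarrow> M\<close> decomposes \<open>M\<close>.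
\<close>

section \<open>Additive structure of the morphism sets\<close>

lemma mor_group_simps [simp]:
  "carrier (mor_group C A B) = mor C A B"
  "monoid.mult (mor_group C A B) = madd C"
  "monoid.one (mor_group C A B) = mzero C A B"
  by (simp_all add: mor_group_def)

context additive_cat
begin

lemma mor_src: "f \<in> mor C A B \<Longrightarrow> A \<in> obj C"
  using src_obj by (auto simp: mor_def)

lemma mor_tgt: "f \<in> mor C A B \<Longrightarrow> B \<in> obj C"
  using tgt_obj by (auto simp: mor_def)

lemma mor_group_group:
  assumes "A \<in> obj C" "B \<in> obj C"
  shows "group (mor_group C A B)"
  using mor_comm_group[OF assms] by (rule comm_group.axioms(2))

lemma mzero_mor: "\<lbrakk>A \<in> obj C; B \<in> obj C\<rbrakk> \<Longrightarrow> mzero C A B \<in> mor C A B"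
  using monoid.one_closed[OF group.is_monoid[OF mor_group_group]] by simp

lemma madd_mor: "\<lbrakk>f \<in> mor C A B; g \<in> mor C A B\<rbrakk> \<Longrightarrow> madd C f g \<in> mor C A B"
  using monoid.m_closed[OF group.is_monoid[OF mor_group_group], of A B f g]
  by (simp add: mor_src mor_tgt)

lemma madd_assoc:
  "\<lbrakk>f \<in> mor C A B; g \<in> mor C A B; h \<in> mor C A B\<rbrakk>
    \<Longrightarrow> madd C (madd C f g) h = madd C f (madd C g h)"
  using monoid.m_assoc[OF group.is_monoid[OF mor_group_group], of A B f g h]
  by (simp add: mor_src mor_tgt)

lemma madd_mzero: "f \<in> mor C A B \<Longrightarrow> madd C f (mzero C A B) = f"
  using monoid.r_one[OF group.is_monoid[OF mor_group_group], of A B f]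
  by (simp add: mor_src mor_tgt)

lemma mzero_madd: "f \<in> mor C A B \<Longrightarrow> madd C (mzero C A B) f = f"
  using monoid.l_one[OF group.is_monoid[OF mor_group_group], of A B f]
  by (simp add: mor_src mor_tgt)

lemma mneg_eq_inv: "f \<in> mor C A B \<Longrightarrow> mneg C f = m_inv (mor_group C A B) f"
  by (auto simp: mneg_def mor_def)

lemma mneg_mor: "f \<in> mor C A B \<Longrightarrow> mneg C f \<in> mor C A B"
  using group.inv_closed[OF mor_group_group, of A B f]
  by (simp add: mor_src mor_tgt mneg_eq_inv)

lemma madd_mneg: "f \<in> mor C A B \<Longrightarrow> madd C f (mneg C f) = mzero C A B"
  using group.r_inv[OF mor_group_group, of A B f]
  by (simp add: mor_src mor_tgt mneg_eq_inv)

lemma mneg_madd: "f \<in> mor C A B \<Longrightarrow> madd C (mneg C f) f = mzero C A B"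
  using group.l_inv[OF mor_group_group, of A B f]
  by (simp add: mor_src mor_tgt mneg_eq_inv)

lemma mneg_unique:
  assumes f: "f \<in> mor C A B" and g: "g \<in> mor C A B" and "madd C g f = mzero C A B"
  shows "g = mneg C f"
  using group.inv_equality[OF mor_group_group, of A B g f] assms
  by (simp add: mor_src[OF f] mor_tgt[OF f] mneg_eq_inv[OF f])

lemma mneg_mneg: "f \<in> mor C A B \<Longrightarrow> mneg C (mneg C f) = f"
  using mneg_unique[OF mneg_mor _ madd_mneg] by simp

text \<open>Cancelling one summand. This is how additive operations are shown to preserve zero
  morphisms.\<close>

lemma madd_self_zero:
  assumes f: "f \<in> mor C A B" and "madd C f f = f"
  shows "f = mzero C A B"
  using madd_assoc[OF f f mneg_mor[OF f]] assms by (simp add: madd_mneg[OF f] madd_mzero[OF f])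

lemma mneg_mzero: "\<lbrakk>A \<in> obj C; B \<in> obj C\<rbrakk> \<Longrightarrow> mneg C (mzero C A B) = mzero C A B"
  by (metis madd_mzero mneg_unique mzero_mor)

lemma mneg_inject: "\<lbrakk>f \<in> mor C A B; g \<in> mor C A B; mneg C f = mneg C g\<rbrakk> \<Longrightarrow> f = g"
  by (metis mneg_mneg)

lemma comp_mzero:
  assumes g: "g \<in> mor C B D" and A: "A \<in> obj C"
  shows "g \<cdot> mzero C A B = mzero C A D"
proof (rule madd_self_zero)
  have z: "mzero C A B \<in> mor C A B" by (rule mzero_mor[OF A mor_src[OF g]])
  show "g \<cdot> mzero C A B \<in> mor C A D" by (rule comp_mor[OF z g])
  show "madd C (g \<cdot> mzero C A B) (g \<cdot> mzero C A B) = g \<cdot> mzero C A B"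
    using comp_madd[OF z z g] by (simp add: madd_mzero[OF z])
qed

lemma mzero_comp:
  assumes f: "f \<in> mor C A B" and D: "D \<in> obj C"
  shows "mzero C B D \<cdot> f = mzero C A D"
proof (rule madd_self_zero)
  have z: "mzero C B D \<in> mor C B D" by (rule mzero_mor[OF mor_tgt[OF f] D])
  show "mzero C B D \<cdot> f \<in> mor C A D" by (rule comp_mor[OF f z])
  show "madd C (mzero C B D \<cdot> f) (mzero C B D \<cdot> f) = mzero C B D \<cdot> f"
    using madd_comp[OF f z z] by (simp add: madd_mzero[OF z])
qed

lemma comp_mneg:
  assumes f: "f \<in> mor C A B" and g: "g \<in> mor C B D"
  shows "g \<cdot> mneg C f = mneg C (g \<cdot> f)"
  using comp_madd[OF mneg_mor[OF f] f g]
  by (intro mneg_unique[OF comp_mor[OF f g] comp_mor[OF mneg_mor[OF f] g]])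
    (simp add: mneg_madd[OF f] comp_mzero[OF g mor_src[OF f]])

lemma mneg_comp:
  assumes f: "f \<in> mor C A B" and g: "g \<in> mor C B D"
  shows "mneg C g \<cdot> f = mneg C (g \<cdot> f)"
  using madd_comp[OF f mneg_mor[OF g] g]
  by (intro mneg_unique[OF comp_mor[OF f g] comp_mor[OF f mneg_mor[OF g]]])
    (simp add: mneg_madd[OF g] mzero_comp[OF f mor_tgt[OF g]])

text \<open>The left inverse is 1 - d, because (1 - d)(1 + d) = 1 - d^2.\<close>

lemma left_inverse_one_plus_nilpotent:
  assumes d: "d \<in> mor C Z Z" and dd: "d \<cdot> d = mzero C Z Z"
  shows "\<exists>v \<in> mor C Z Z. v \<cdot> madd C (ident C Z) d = ident C Z"
proof -
  have Z: "Z \<in> obj C" by (rule mor_src[OF d])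
  note one = ident_mor[OF Z] and nd = mneg_mor[OF d]
  define v where "v = madd C (ident C Z) (mneg C d)"
  have v: "v \<in> mor C Z Z" unfolding v_def by (rule madd_mor[OF one nd])
  have vd: "v \<cdot> d = d"
    unfolding v_def madd_comp[OF d one nd]
    by (simp add: ident_comp[OF d] mneg_comp[OF d d] dd mneg_mzero[OF Z Z] madd_mzero[OF d])
  have "v \<cdot> madd C (ident C Z) d = madd C v d"
    by (simp add: comp_madd[OF one d v] comp_ident[OF v] vd)
  also have "\<dots> = ident C Z"
    unfolding v_def by (simp add: madd_assoc[OF one nd d] mneg_madd[OF d] madd_mzero[OF one])
  finally show ?thesis using v by blast
qed

end

section \<open>Triangles\<close>

context triangulated_cat
begin

text \<open>Forgetting the morphisms absorbs the signs created by rotation. The objects are listed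
  in the order of the triangle, unlike in \<open>extension_of\<close>.\<close>

abbreviation tri :: "'a \<Rightarrow> 'a \<Rightarrow> 'a \<Rightarrow> bool" where
  "tri X Y Z \<equiv> extension_of C Y Z X"

lemma sh_obj: "A \<in> obj C \<Longrightarrow> sh C A \<in> obj C"
  using sh_bij by (auto simp: bij_betw_def)

lemma sh_inject: "\<lbrakk>sh C A = sh C B; A \<in> obj C; B \<in> obj C\<rbrakk> \<Longrightarrow> A = B"
  using sh_bij by (auto simp: bij_betw_def inj_on_def)

lemma sh_surj:
  assumes "B \<in> obj C"
  obtains A where "A \<in> obj C" "B = sh C A"
  using sh_bij assms by (auto simp: bij_betw_def)

lemma shm_inject: "\<lbrakk>shm C f = shm C g; f \<in> mor C A B; g \<in> mor C A' B'\<rbrakk> \<Longrightarrow> f = g"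
  using shm_bij by (auto simp: bij_betw_def inj_on_def mor_def)

text \<open>Bijectivity on all arrows yields some preimage; its endpoints are the right ones because
  translation is injective on objects.\<close>

lemma shm_full:
  assumes h: "h \<in> mor C (sh C A) (sh C B)" and AB: "A \<in> obj C" "B \<in> obj C"
  obtains f where "f \<in> mor C A B" "shm C f = h"
proof -
  obtain f where f: "f \<in> arr C" "shm C f = h"
    using shm_bij h by (force simp: bij_betw_def mor_def)
  then have m: "f \<in> mor C (src C f) (tgt C f)" by (simp add: mor_def)
  have "sh C (src C f) = sh C A" "sh C (tgt C f) = sh C B"
    using shm_mor[OF m] h f by (auto simp: mor_def)
  then have "src C f = A" "tgt C f = B"
    using AB mor_src[OF m] mor_tgt[OF m] by (auto dest: sh_inject)
  with m f that show thesis by auto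
qed

lemma shm_mzero:
  assumes AB: "A \<in> obj C" "B \<in> obj C"
  shows "shm C (mzero C A B) = mzero C (sh C A) (sh C B)"
  using shm_madd[OF mzero_mor[OF AB] mzero_mor[OF AB]]
  by (intro madd_self_zero shm_mor mzero_mor AB) (simp add: madd_mzero[OF mzero_mor[OF AB]])

lemma dtriangleD:
  assumes "dtriangle C X Y Z f g h"
  shows "f \<in> mor C X Y" "g \<in> mor C Y Z" "h \<in> mor C Z (sh C X)"
    "X \<in> obj C" "Y \<in> obj C" "Z \<in> obj C"
  using assms mor_src mor_tgt by (auto simp: dtriangle_def triangle_def)

lemma dtriangle_rotate:
  "dtriangle C X Y Z f g h \<Longrightarrow> dtriangle C Y Z (sh C X) g h (mneg C (shm C f))"
  using TR2 by (auto simp: dtriangle_def)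

lemma dtriangle_unrotate:
  assumes d: "dtriangle C Y Z (sh C X) g h k" and X: "X \<in> obj C"
  obtains f where "dtriangle C X Y Z f g h"
proof -
  note k = dtriangleD[OF d]
  \<comment> \<open>Rotation produces the third morphism -f[1], so f has to desuspend -k.\<close>
  obtain f where f: "f \<in> mor C X Y" "shm C f = mneg C k"
    using shm_full[OF mneg_mor[OF k(3)] X k(4)] by blast
  then have "triangle C X Y Z f g h" "mneg C (shm C f) = k"
    using k by (auto simp: triangle_def mneg_mneg)
  with TR2 d that show thesis by blast
qed

lemma dtriangle_shift:
  assumes "dtriangle C X Y Z f g h"
  shows "dtriangle C (sh C X) (sh C Y) (sh C Z)
    (mneg C (shm C f)) (mneg C (shm C g)) (mneg C (shm C h))"
  by (intro dtriangle_rotate assms)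

lemma triI: "dtriangle C X Y Z f g h \<Longrightarrow> tri X Y Z"
  by (auto simp: extension_of_def)

lemma triE:
  assumes "tri X Y Z"
  obtains f g h where "dtriangle C X Y Z f g h"
  using assms by (auto simp: extension_of_def)

lemma tri_obj: "tri X Y Z \<Longrightarrow> X \<in> obj C" "tri X Y Z \<Longrightarrow> Y \<in> obj C" "tri X Y Z \<Longrightarrow> Z \<in> obj C"
  by (auto elim!: triE dest: dtriangleD)

lemma tri_rotate: "tri X Y Z \<Longrightarrow> tri Y Z (sh C X)"
  by (meson triE triI dtriangle_rotate)

lemma tri_unrotate: "\<lbrakk>tri Y Z (sh C X); X \<in> obj C\<rbrakk> \<Longrightarrow> tri X Y Z"
  by (meson triE triI dtriangle_unrotate)

lemma tri_shift_iff:
  assumes "X \<in> obj C" "Y \<in> obj C" "Z \<in> obj C"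
  shows "tri (sh C X) (sh C Y) (sh C Z) \<longleftrightarrow> tri X Y Z"
  by (meson assms tri_rotate tri_unrotate)

text \<open>Of the octahedral axiom only the triangle formed by the three cones is retained.\<close>

lemma octahedron:
  assumes "dtriangle C X Y A f f1 f2" "dtriangle C Y Z B g g1 g2"
    and "dtriangle C X Z D (g \<cdot> f) k1 k2"
  shows "tri A D B"
  using TR4[OF assms] by (auto intro: triI)

section \<open>Vanishing composites, weak kernels and weak cokernels in a triangle\<close>

lemma dtriangle_comp_zero:
  assumes d: "dtriangle C X Y Z f g h"
  shows "g \<cdot> f = mzero C X Z"
proof -
  note t = dtriangleD[OF d]
  \<comment> \<open>TR3 for the pair (1, f), starting from the triangle X -> X -> 0, factors g f
    through the zero object.\<close>
  obtain w where w: "w \<in> mor C (zobj C) Z" "w \<cdot> mzero C X (zobj C) = g \<cdot> f"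
    using TR3[OF TR1_ident[OF t(4)] d ident_mor[OF t(4)] t(1)] by auto
  then show ?thesis using comp_mzero[OF w(1) t(4)] by simp
qed

text \<open>TR3 compares A -> 0 -> A[1] with Y -> Z -> X[1] along the pair (a, 0). The resulting map
  A[1] -> X[1] desuspends to b, and the signs on both sides cancel.\<close>

lemma dtriangle_weak_kernel:
  assumes d: "dtriangle C X Y Z f g h" and a: "a \<in> mor C A Y" and ga: "g \<cdot> a = mzero C A Z"
  obtains b where "b \<in> mor C A X" "f \<cdot> b = a"
proof -
  note t = dtriangleD[OF d] and A = mor_src[OF a]
  note z = zobj_obj
  have "mzero C (zobj C) Z \<cdot> mzero C A (zobj C) = g \<cdot> a"
    using ga comp_mzero[OF mzero_mor[OF z t(6)] A] by simp
  then obtain w where w: "w \<in> mor C (sh C A) (sh C X)"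
      "shm C a \<cdot> mneg C (shm C (ident C A)) = mneg C (shm C f) \<cdot> w"
    using TR3[OF dtriangle_rotate[OF TR1_ident[OF A]] dtriangle_rotate[OF d] a mzero_mor[OF z t(6)]]
    by auto
  obtain b where b: "b \<in> mor C A X" "shm C b = w"
    using shm_full[OF w(1) A t(4)] .
  have "mneg C (shm C a) = mneg C (shm C (f \<cdot> b))"
    using w(2) b
    by (simp add: comp_mneg[OF ident_mor[OF sh_obj[OF A]] shm_mor[OF a]] shm_ident[OF A]
        comp_ident[OF shm_mor[OF a]] mneg_comp[OF w(1) shm_mor[OF t(1)]] shm_comp[OF b(1) t(1)])
  then have "shm C (f \<cdot> b) = shm C a"
    using mneg_inject[OF shm_mor[OF a] shm_mor[OF comp_mor[OF b(1) t(1)]]] by simp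
  then show thesis
    using that b(1) shm_inject[OF _ comp_mor[OF b(1) t(1)] a] by blast
qed

text \<open>Dually, TR3 leads into 0 -> A[1] -> A[1], obtained from A -> A -> 0 by two rotations.
  Hence the given triangle is translated first and the factorization desuspended at the end.\<close>

lemma dtriangle_weak_cokernel:
  assumes d: "dtriangle C X Y Z f g h" and a: "a \<in> mor C Y A" and af: "a \<cdot> f = mzero C X A"
  obtains b where "b \<in> mor C Z A" "b \<cdot> g = a"
proof -
  note t = dtriangleD[OF d] and A = mor_tgt[OF a]
  note z = zobj_obj
  note iA = ident_mor[OF sh_obj[OF A]]
  let ?u = "mzero C (sh C X) (zobj C)"
  have u: "?u \<in> mor C (sh C X) (zobj C)" by (rule mzero_mor[OF sh_obj[OF t(4)] z])
  have "shm C a \<cdot> mneg C (shm C f) = mzero C (sh C X) (sh C A)"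
    using shm_comp[OF t(1) a, symmetric] af
    by (simp add: comp_mneg[OF shm_mor[OF t(1)] shm_mor[OF a]] shm_mzero t A sh_obj mneg_mzero)
  then have "shm C a \<cdot> mneg C (shm C f) = mzero C (zobj C) (sh C A) \<cdot> ?u"
    using mzero_comp[OF u sh_obj[OF A]] by simp
  then obtain w where w: "w \<in> mor C (sh C Z) (sh C A)"
      "w \<cdot> mneg C (shm C g) = mneg C (shm C (ident C A)) \<cdot> shm C a"
    using TR3[OF dtriangle_shift[OF d] dtriangle_rotate[OF dtriangle_rotate[OF TR1_ident[OF A]]]
        u shm_mor[OF a]] by auto
  obtain b where b: "b \<in> mor C Z A" "shm C b = w"
    using shm_full[OF w(1) t(6) A] .
  have "mneg C (shm C (b \<cdot> g)) = mneg C (shm C a)"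
    using w(2) b
    by (simp add: mneg_comp[OF shm_mor[OF a] iA] shm_ident[OF A]
        ident_comp[OF shm_mor[OF a]] comp_mneg[OF shm_mor[OF t(2)] w(1)] shm_comp[OF t(2) b(1)])
  then have "shm C (b \<cdot> g) = shm C a"
    using mneg_inject[OF shm_mor[OF comp_mor[OF t(2) b(1)]] shm_mor[OF a]] by simp
  then show thesis
    using that b(1) shm_inject[OF _ comp_mor[OF t(2) b(1)] a] by blast
qed

text \<open>The translation of \<open>zobj C\<close> is isomorphic, but perhaps not equal, to
  \<open>zobj C\<close>. This triangle places all such copies in every extension-closed
  class.\<close>

lemma tri_zero_object:
  assumes Y: "Y \<in> obj C" and idY: "ident C Y = mzero C Y Y"
  shows "tri (zobj C) Y (zobj C)"
proof -
  note z = zobj_obj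
  let ?i = "mzero C (zobj C) Y" and ?p = "mzero C Y (zobj C)"
  have i: "?i \<in> mor C (zobj C) Y" and p: "?p \<in> mor C Y (zobj C)"
    using mzero_mor Y z by auto
  have id0: "ident C (zobj C) = mzero C (zobj C) (zobj C)"
    using ident_mor[OF z] zobj_initial[OF z] by simp
  have "?p \<cdot> ?i = ident C (zobj C)" "?i \<cdot> ?p = ident C Y"
    using comp_mzero[OF p z] comp_mzero[OF i Y] id0 idY by auto
  then have isoY: "is_iso C (zobj C) Y ?i" using i p by (auto simp: is_iso_def)
  have iso0: "is_iso C (zobj C) (zobj C) (ident C (zobj C))"
    using ident_mor[OF z] comp_ident[OF ident_mor[OF z]] by (auto simp: is_iso_def)
  let ?h = "mzero C (zobj C) (sh C (zobj C))"
  have h: "?h \<in> mor C (zobj C) (sh C (zobj C))" by (rule mzero_mor[OF z sh_obj[OF z]])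
  have m: "mzero C (zobj C) (zobj C) \<in> mor C (zobj C) (zobj C)" by (rule mzero_mor[OF z z])
  have "dtriangle C (zobj C) Y (zobj C) ?i ?p ?h"
  proof (rule TR1_iso[OF TR1_ident[OF z] _ iso0 isoY iso0])
    show "triangle C (zobj C) Y (zobj C) ?i ?p ?h" using i p h by (simp add: triangle_def)
    show "?i \<cdot> ident C (zobj C) = ?i \<cdot> ident C (zobj C)" ..
    show "ident C (zobj C) \<cdot> mzero C (zobj C) (zobj C) = ?p \<cdot> ?i"
      using comp_mzero[OF p z] ident_comp[OF m] by simp
    show "shm C (ident C (zobj C)) \<cdot> ?h = ?h \<cdot> ident C (zobj C)"
      using shm_ident[OF z] ident_comp[OF h] comp_ident[OF h] by simp
  qed
  then show ?thesis by (rule triI)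
qed

lemma tri_sh_zobj: "tri (zobj C) (sh C (zobj C)) (zobj C)"
proof (rule tri_zero_object[OF sh_obj[OF zobj_obj]])
  have "ident C (zobj C) = mzero C (zobj C) (zobj C)"
    using ident_mor zobj_initial zobj_obj by blast
  then show "ident C (sh C (zobj C)) = mzero C (sh C (zobj C)) (sh C (zobj C))"
    using shm_ident shm_mzero zobj_obj by metis
qed

lemma tri_unsh_zobj:
  assumes Y: "Y \<in> obj C" and sY: "sh C Y = zobj C"
  shows "tri (zobj C) Y (zobj C)"
proof (rule tri_zero_object[OF Y], rule shm_inject[OF _ ident_mor[OF Y] mzero_mor[OF Y Y]])
  have "ident C (zobj C) = mzero C (zobj C) (zobj C)"
    using ident_mor zobj_initial zobj_obj by blast
  then show "shm C (ident C Y) = shm C (mzero C Y Y)"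
    using shm_ident[OF Y] shm_mzero[OF Y Y] sY by simp
qed


section \<open>Retracts\<close>

lemma retract_of_factor:
  assumes "i \<in> mor C X Y" "p \<in> mor C Y X" "p \<cdot> i = ident C X"
  shows "retract_of C X Y"
  using assms mor_src mor_tgt by (auto simp: retract_of_def)

lemma retract_sh_iff:
  assumes X: "X \<in> obj C" and Y: "Y \<in> obj C"
  shows "retract_of C (sh C X) (sh C Y) \<longleftrightarrow> retract_of C X Y"
proof
  assume "retract_of C X Y"
  then obtain i p where ip: "i \<in> mor C X Y" "p \<in> mor C Y X" "p \<cdot> i = ident C X"
    by (auto simp: retract_of_def)
  then have "shm C p \<cdot> shm C i = ident C (sh C X)"
    using shm_comp[OF ip(1,2)] shm_ident[OF X] by simp
  then show "retract_of C (sh C X) (sh C Y)"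
    by (rule retract_of_factor[OF shm_mor[OF ip(1)] shm_mor[OF ip(2)]])
next
  assume "retract_of C (sh C X) (sh C Y)"
  then obtain i' p' where ip': "i' \<in> mor C (sh C X) (sh C Y)" "p' \<in> mor C (sh C Y) (sh C X)"
      "p' \<cdot> i' = ident C (sh C X)"
    by (auto simp: retract_of_def)
  obtain i where i: "i \<in> mor C X Y" "shm C i = i'" using shm_full[OF ip'(1) X Y] .
  obtain p where p: "p \<in> mor C Y X" "shm C p = p'" using shm_full[OF ip'(2) Y X] .
  have "shm C (p \<cdot> i) = shm C (ident C X)"
    using shm_comp[OF i(1) p(1)] i p ip' shm_ident[OF X] by simp
  then have "p \<cdot> i = ident C X"
    using shm_inject comp_mor[OF i(1) p(1)] ident_mor[OF X] by blast
  then show "retract_of C X Y" by (rule retract_of_factor[OF i(1) p(1)])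
qed

lemma retract_of_refl: "X \<in> obj C \<Longrightarrow> retract_of C X X"
  using retract_of_factor[OF ident_mor ident_mor comp_ident[OF ident_mor]] by blast

lemma retract_of_trans:
  assumes "retract_of C X Y" "retract_of C Y Z"
  shows "retract_of C X Z"
proof -
  obtain i p where a: "i \<in> mor C X Y" "p \<in> mor C Y X" "p \<cdot> i = ident C X"
    using assms by (auto simp: retract_of_def)
  obtain j q where b: "j \<in> mor C Y Z" "q \<in> mor C Z Y" "q \<cdot> j = ident C Y"
    using assms by (auto simp: retract_of_def)
  have ji: "j \<cdot> i \<in> mor C X Z" by (rule comp_mor[OF a(1) b(1)])
  have "(p \<cdot> q) \<cdot> (j \<cdot> i) = p \<cdot> ((q \<cdot> j) \<cdot> i)"
    using comp_assoc[OF ji b(2) a(2)] comp_assoc[OF a(1) b(1,2)] by simp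
  also have "\<dots> = ident C X" using a b(3) ident_comp[OF a(1)] by simp
  finally show ?thesis by (rule retract_of_factor[OF ji comp_mor[OF b(2) a(2)]])
qed

text \<open>An endomorphism of a triangle that is the identity on two of the three objects is
  \<open>1 + d\<close> with \<open>d\<^sup>2 = 0\<close> on the third one, hence invertible.\<close>

lemma triangle_endo_left_inverse:
  assumes t: "dtriangle C X Y Z f g h" and w: "w \<in> mor C Z Z" and wg: "w \<cdot> g = g" and hw: "h \<cdot> w = h"
  shows "\<exists>v \<in> mor C Z Z. v \<cdot> w = ident C Z"
proof -
  note T = dtriangleD[OF t]
  note one = ident_mor[OF T(6)] and none = mneg_mor[OF ident_mor[OF T(6)]]
  define d where "d = madd C (mneg C (ident C Z)) w"
  have d: "d \<in> mor C Z Z" unfolding d_def by (rule madd_mor[OF none w])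
  have w_eq: "madd C (ident C Z) d = w"
    unfolding d_def by (simp add: madd_assoc[OF one none w, symmetric] madd_mneg[OF one] mzero_madd[OF w])
  have "d \<cdot> g = mzero C Y Z"
    unfolding d_def madd_comp[OF T(2) none w]
    by (simp add: mneg_comp[OF T(2) one] ident_comp[OF T(2)] wg mneg_madd[OF T(2)])
  \<comment> \<open>As d g = 0, d factors as e h; together with h d = 0 this gives d^2 = e h d =
    0.\<close>
  then obtain e where e: "e \<in> mor C (sh C X) Z" "e \<cdot> h = d"
    using dtriangle_weak_cokernel[OF dtriangle_rotate[OF t] d] by blast
  have hd: "h \<cdot> d = mzero C Z (sh C X)"
    unfolding d_def comp_madd[OF none w T(3)]
    by (simp add: comp_mneg[OF one T(3)] comp_ident[OF T(3)] hw mneg_madd[OF T(3)])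
  have "d \<cdot> d = e \<cdot> (h \<cdot> d)"
    using comp_assoc[OF d T(3) e(1)] e(2) by simp
  then have "d \<cdot> d = mzero C Z Z"
    using hd comp_mzero[OF e(1) T(6)] by simp
  from left_inverse_one_plus_nilpotent[OF d this] show ?thesis unfolding w_eq .
qed

text \<open>With F = j f p, the pairs (i, j) and (p, q) are compatible with f and F, so TR3 gives
  maps u and v between the cones. The composite v u need not be 1, but it completes identities to an
  endomorphism of the triangle, so a left inverse r corrects the retraction to r v.\<close>

lemma retract_of_cone:
  assumes t: "dtriangle C A B Z f g h" and A: "retract_of C A A'" and B: "retract_of C B B'"
  obtains f' g' h' W where "dtriangle C A' B' W f' g' h'" "retract_of C Z W"
proof -
  note T = dtriangleD[OF t]
  obtain i p where a: "i \<in> mor C A A'" "p \<in> mor C A' A" "p \<cdot> i = ident C A"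
    using A by (auto simp: retract_of_def)
  obtain j q where b: "j \<in> mor C B B'" "q \<in> mor C B' B" "q \<cdot> j = ident C B"
    using B by (auto simp: retract_of_def)
  define F where "F = j \<cdot> (f \<cdot> p)"
  have fp: "f \<cdot> p \<in> mor C A' B" by (rule comp_mor[OF a(2) T(1)])
  have F: "F \<in> mor C A' B'" unfolding F_def by (rule comp_mor[OF fp b(1)])
  obtain W G H where W: "dtriangle C A' B' W F G H" using TR1_cone[OF F] by blast
  note TW = dtriangleD[OF W]
  have "j \<cdot> f = F \<cdot> i"
    unfolding F_def comp_assoc[OF a(1) fp b(1)] comp_assoc[OF a(1,2) T(1)] a(3) comp_ident[OF T(1)] ..
  then obtain u where u: "u \<in> mor C Z W" "u \<cdot> g = G \<cdot> j" "shm C i \<cdot> h = H \<cdot> u"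
    using TR3[OF t W a(1) b(1)] by blast
  have "q \<cdot> F = f \<cdot> p"
    unfolding F_def comp_assoc[OF fp b(1,2), symmetric] b(3) by (rule ident_comp[OF fp])
  then obtain v where v: "v \<in> mor C W Z" "v \<cdot> G = g \<cdot> q" "shm C p \<cdot> H = h \<cdot> v"
    using TR3[OF W t a(2) b(2)] by blast
  have vu: "v \<cdot> u \<in> mor C Z Z" by (rule comp_mor[OF u(1) v(1)])
  have 1: "(v \<cdot> u) \<cdot> g = g"
  proof -
    have "(v \<cdot> u) \<cdot> g = v \<cdot> (G \<cdot> j)" using comp_assoc[OF T(2) u(1) v(1)] u(2) by simp
    also have "\<dots> = (g \<cdot> q) \<cdot> j" using comp_assoc[OF b(1) TW(2) v(1)] v(2) by simp
    also have "\<dots> = g" using comp_assoc[OF b(1,2) T(2)] b(3) comp_ident[OF T(2)] by simp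
    finally show ?thesis .
  qed
  have 2: "h \<cdot> (v \<cdot> u) = h"
  proof -
    have "h \<cdot> (v \<cdot> u) = (shm C p \<cdot> H) \<cdot> u" using comp_assoc[OF u(1) v(1) T(3)] v(3) by simp
    also have "\<dots> = shm C p \<cdot> (shm C i \<cdot> h)"
      using comp_assoc[OF u(1) TW(3) shm_mor[OF a(2)]] u(3) by simp
    also have "\<dots> = shm C (p \<cdot> i) \<cdot> h"
      using comp_assoc[OF T(3) shm_mor[OF a(1)] shm_mor[OF a(2)]] shm_comp[OF a(1,2)] by simp
    also have "\<dots> = h" using a(3) shm_ident[OF T(4)] ident_comp[OF T(3)] by simp
    finally show ?thesis .
  qed
  obtain r where r: "r \<in> mor C Z Z" "r \<cdot> (v \<cdot> u) = ident C Z"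
    using triangle_endo_left_inverse[OF t vu 1 2] by blast
  then have "(r \<cdot> v) \<cdot> u = ident C Z" using comp_assoc[OF u(1) v(1) r(1)] by simp
  then have "retract_of C Z W" by (rule retract_of_factor[OF u(1) comp_mor[OF v(1) r(1)]])
  with W that show thesis by blast
qed

text \<open>The complement is the desuspended cone of the retraction p. A splitting of j is built
  from the idempotent 1 - i p.\<close>

lemma retract_complement:
  assumes "retract_of C M N"
  obtains M' where "tri M' N M" "retract_of C M' N"
proof -
  obtain i p where a: "i \<in> mor C M N" "p \<in> mor C N M" "p \<cdot> i = ident C M"
    using assms by (auto simp: retract_of_def)
  obtain K g k where K: "dtriangle C N M K p g k" using TR1_cone[OF a(2)] by blast
  note TK = dtriangleD[OF K]
  obtain M' where M': "M' \<in> obj C" "K = sh C M'" using sh_surj[OF TK(6)] .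
  obtain j where t: "dtriangle C M' N M j p g"
    using dtriangle_unrotate[OF K[unfolded M'(2)] M'(1)] .
  note T = dtriangleD[OF t]
  \<comment> \<open>The composite g p vanishes and p has the section i, so g itself
    vanishes.\<close>
  have g0: "g = mzero C M (sh C M')"
  proof -
    have "g = (g \<cdot> p) \<cdot> i" using comp_assoc[OF a(1,2) T(3)] a(3) comp_ident[OF T(3)] by simp
    then show ?thesis using dtriangle_comp_zero[OF K] mzero_comp[OF a(1) TK(6)] M'(2) by simp
  qed
  note one = ident_mor[OF T(5)] and ip = comp_mor[OF a(2,1)]
  \<comment> \<open>The projector onto the complement: it is killed by p and hence lifts through
    j.\<close>
  define e where "e = madd C (ident C N) (mneg C (i \<cdot> p))"
  have e: "e \<in> mor C N N" unfolding e_def by (rule madd_mor[OF one mneg_mor[OF ip]])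
  have "p \<cdot> e = mzero C N M"
  proof -
    have "p \<cdot> (i \<cdot> p) = p" using comp_assoc[OF a(2,1,2)] a(3) ident_comp[OF a(2)] by simp
    then show ?thesis
      unfolding e_def comp_madd[OF one mneg_mor[OF ip] a(2)]
      by (simp add: comp_ident[OF a(2)] comp_mneg[OF ip a(2)] madd_mneg[OF a(2)])
  qed
  then obtain q where q: "q \<in> mor C N M'" "j \<cdot> q = e"
    using dtriangle_weak_kernel[OF t e] by blast
  have ej: "e \<cdot> j = j"
  proof -
    have "(i \<cdot> p) \<cdot> j = mzero C M' N"
      using comp_assoc[OF T(1) a(2,1)] dtriangle_comp_zero[OF t] comp_mzero[OF a(1) T(4)] by simp
    then show ?thesis
      unfolding e_def madd_comp[OF T(1) one mneg_mor[OF ip]]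
      by (simp add: ident_comp[OF T(1)] mneg_comp[OF T(1) ip] mneg_mzero T(4,5) madd_mzero[OF T(1)])
  qed
  note qj = comp_mor[OF T(1) q(1)] and one' = ident_mor[OF T(4)]
  \<comment> \<open>The defect of q j = 1. Since j x = 0, the map x[1] factors through g, which is
    zero.\<close>
  define x where "x = madd C (q \<cdot> j) (mneg C (ident C M'))"
  have x: "x \<in> mor C M' M'" unfolding x_def by (rule madd_mor[OF qj mneg_mor[OF one']])
  have jx: "j \<cdot> x = mzero C M' N"
  proof -
    have "j \<cdot> (q \<cdot> j) = j" using comp_assoc[OF T(1) q(1) T(1)] q(2) ej by simp
    then show ?thesis
      unfolding x_def comp_madd[OF qj mneg_mor[OF one'] T(1)]
      by (simp add: comp_mneg[OF one' T(1)] comp_ident[OF T(1)] madd_mneg[OF T(1)])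
  qed
  have "mneg C (shm C j) \<cdot> shm C x = mzero C (sh C M') (sh C N)"
    using mneg_comp[OF shm_mor[OF x] shm_mor[OF T(1)]] shm_comp[OF x T(1), symmetric] jx
    by (simp add: shm_mzero T sh_obj mneg_mzero)
  then obtain y where y: "y \<in> mor C (sh C M') M" "g \<cdot> y = shm C x"
    using dtriangle_weak_kernel[OF dtriangle_rotate[OF dtriangle_rotate[OF t]] shm_mor[OF x]] by blast
  have "shm C x = shm C (mzero C M' M')"
    using y g0 mzero_comp[OF y(1) sh_obj[OF M'(1)]] shm_mzero[OF M'(1) M'(1)] by simp
  then have "x = mzero C M' M'" using shm_inject x mzero_mor[OF M'(1) M'(1)] by blast
  then have "q \<cdot> j = ident C M'"
    using mneg_unique[OF mneg_mor[OF one'] qj] mneg_mneg[OF one'] by (simp add: x_def)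
  then have "retract_of C M' N" by (rule retract_of_factor[OF T(1) q(1)])
  with triI[OF t] that show thesis by blast
qed


section \<open>Integral shifts\<close>

lemma shift_1: "shift C 1 = sh C"
  by (simp add: shift_def fun_eq_iff)

lemma shift_0: "shift C 0 X = X"
  by (simp add: shift_def)

lemma unsh_obj: "X \<in> obj C \<Longrightarrow> the_inv_into (obj C) (sh C) X \<in> obj C"
  using sh_bij by (simp add: bij_betw_def the_inv_into_into)

lemma sh_unsh: "X \<in> obj C \<Longrightarrow> sh C (the_inv_into (obj C) (sh C) X) = X"
  using sh_bij by (simp add: bij_betw_def f_the_inv_into_f)

lemma shift_obj:
  assumes "X \<in> obj C"
  shows "shift C n X \<in> obj C"
proof -
  have "(sh C ^^ k) X \<in> obj C" for k by (induction k) (auto simp: assms sh_obj)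
  moreover have "(the_inv_into (obj C) (sh C) ^^ k) X \<in> obj C" for k
    by (induction k) (auto simp: assms unsh_obj)
  ultimately show ?thesis by (simp add: shift_def)
qed

lemma shift_Suc:
  assumes "X \<in> obj C"
  shows "shift C (n + 1) X = sh C (shift C n X)"
proof (cases "0 \<le> n")
  case True
  then have "nat (n + 1) = Suc (nat n)" by simp
  with True show ?thesis by (simp add: shift_def)
next
  case False
  define k where "k = nat (- (n + 1))"
  have n: "nat (- n) = Suc k" using False by (simp add: k_def)
  let ?u = "the_inv_into (obj C) (sh C)"
  have "shift C (n + 1) X = (?u ^^ k) X"
    \<comment> \<open>At n = -1 the left side enters the nonnegative branch of \<open>shift\<close>;
      there k = 0, so both sides are X.\<close>
    using False by (cases "n = -1") (auto simp: shift_def k_def)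
  moreover have "(?u ^^ k) X \<in> obj C" by (induction k) (auto simp: assms unsh_obj)
  moreover have "shift C n X = ?u ((?u ^^ k) X)"
    using False n by (simp add: shift_def)
  ultimately show ?thesis using sh_unsh by simp
qed

lemma shift_add:
  assumes X: "X \<in> obj C"
  shows "shift C (m + n) X = shift C m (shift C n X)"
proof (induction m rule: int_induct[where k = 0])
  case base
  show ?case by (simp add: shift_0)
next
  case (step1 i)
  then show ?case
    using shift_Suc[OF X, of "i + n"] shift_Suc[OF shift_obj[OF X], of i n] by (simp add: algebra_simps)
next
  case (step2 i)
  have "sh C (shift C (i - 1 + n) X) = sh C (shift C (i - 1) (shift C n X))"
    using step2 shift_Suc[OF X, of "i - 1 + n"] shift_Suc[OF shift_obj[OF X], of "i - 1" n]
    by (simp add: algebra_simps)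
  then show ?case using sh_inject shift_obj X by blast
qed

lemma sh_image_shift:
  assumes "D \<subseteq> obj C"
  shows "sh C ` shift C n ` D = shift C (n + 1) ` D"
  unfolding image_image by (rule image_cong) (use assms shift_Suc in auto)

lemma shift_shift_image:
  assumes "D \<subseteq> obj C"
  shows "shift C m ` shift C n ` D = shift C (m + n) ` D"
  unfolding image_image by (rule image_cong) (use assms shift_add in auto)

lemma shift_image_sh: "D \<subseteq> obj C \<Longrightarrow> shift C n ` sh C ` D = shift C (n + 1) ` D"
  using shift_shift_image[of D n 1] by (simp add: shift_1)

lemma shift_image_subset: "D \<subseteq> obj C \<Longrightarrow> shift C n ` D \<subseteq> obj C"
  using shift_obj by auto

section \<open>Closed classes of objects\<close>

lemma extension_closedD:
  assumes "extension_closed C D" "tri A E B" "A \<in> D" "B \<in> D"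
  shows "E \<in> D"
  using assms unfolding extension_closed_def extension_of_def by blast

lemma extension_closed_zobj: "extension_closed C D \<Longrightarrow> zobj C \<in> D"
  unfolding extension_closed_def by (rule conjunct1)

lemma extension_closedI:
  assumes "zobj C \<in> D" "\<And>A E B. \<lbrakk>tri A E B; A \<in> D; B \<in> D\<rbrakk> \<Longrightarrow> E \<in> D"
  shows "extension_closed C D"
  using assms triI unfolding extension_closed_def by blast

lemma extension_closed_Inter:
  assumes "\<And>E. E \<in> F \<Longrightarrow> extension_closed C E"
  shows "extension_closed C (\<Inter> F)"
proof (rule extension_closedI)
  show "zobj C \<in> \<Inter> F" by (rule InterI[OF extension_closed_zobj[OF assms]])
  fix A E B assume t: "tri A E B" and AB: "A \<in> \<Inter> F" "B \<in> \<Inter> F"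
  show "E \<in> \<Inter> F"
  proof (rule InterI)
    fix D assume D: "D \<in> F"
    show "E \<in> D" by (rule extension_closedD[OF assms[OF D] t InterD[OF AB(1) D] InterD[OF AB(2) D]])
  qed
qed

text \<open>Triangles can be translated in both directions. Only the zero object needs care, since
  its translation and desuspension are copies of it and not it itself.\<close>

lemma extension_closed_sh_iff:
  assumes D: "D \<subseteq> obj C"
  shows "extension_closed C (sh C ` D) \<longleftrightarrow> extension_closed C D"
proof
  assume e: "extension_closed C D"
  show "extension_closed C (sh C ` D)"
  proof (rule extension_closedI)
    obtain Z where Z: "Z \<in> obj C" "zobj C = sh C Z" using sh_surj[OF zobj_obj] .
    have "Z \<in> D"
      by (rule extension_closedD[OF e tri_unsh_zobj[OF Z(1) Z(2)[symmetric]]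
            extension_closed_zobj[OF e] extension_closed_zobj[OF e]])
    then show "zobj C \<in> sh C ` D" using Z(2) by blast
  next
    fix A E B assume t: "tri A E B" and "A \<in> sh C ` D" "B \<in> sh C ` D"
    then obtain A' B' where AB: "A' \<in> D" "A = sh C A'" "B' \<in> D" "B = sh C B'" by blast
    obtain E' where E: "E' \<in> obj C" "E = sh C E'" using sh_surj[OF tri_obj(2)[OF t]] .
    have "tri A' E' B'" using t AB D E tri_shift_iff by blast
    then show "E \<in> sh C ` D" using extension_closedD[OF e] AB E by blast
  qed
next
  assume e: "extension_closed C (sh C ` D)"
  have sub: "sh C X \<in> sh C ` D \<Longrightarrow> X \<in> obj C \<Longrightarrow> X \<in> D" for X
    using D sh_inject by blast
  show "extension_closed C D"
  proof (rule extension_closedI)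
    have "sh C (zobj C) \<in> sh C ` D"
      by (rule extension_closedD[OF e tri_sh_zobj extension_closed_zobj[OF e] extension_closed_zobj[OF e]])
    then show "zobj C \<in> D" using sub zobj_obj by blast
  next
    fix A E B assume t: "tri A E B" and AB: "A \<in> D" "B \<in> D"
    have "tri (sh C A) (sh C E) (sh C B)" using t tri_obj[OF t] tri_shift_iff by blast
    then have "sh C E \<in> sh C ` D" using extension_closedD[OF e] AB by blast
    then show "E \<in> D" using sub tri_obj(2)[OF t] by blast
  qed
qed

lemma retraction_closed_sh_iff:
  assumes D: "D \<subseteq> obj C"
  shows "retraction_closed C (sh C ` D) \<longleftrightarrow> retraction_closed C D"
proof
  assume r: "retraction_closed C D"
  show "retraction_closed C (sh C ` D)"
    unfolding retraction_closed_def
  proof (intro ballI allI impI)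
    fix Y X assume "Y \<in> sh C ` D" and XY: "retract_of C X Y"
    then obtain Y' where Y: "Y' \<in> D" "Y = sh C Y'" by blast
    have "X \<in> obj C" using XY by (simp add: retract_of_def)
    then obtain X' where X: "X' \<in> obj C" "X = sh C X'" by (rule sh_surj)
    have "retract_of C X' Y'" using XY X Y D retract_sh_iff by blast
    then show "X \<in> sh C ` D" using r X Y by (auto simp: retraction_closed_def)
  qed
next
  assume r: "retraction_closed C (sh C ` D)"
  show "retraction_closed C D"
    unfolding retraction_closed_def
  proof (intro ballI allI impI)
    fix Y X assume Y: "Y \<in> D" and XY: "retract_of C X Y"
    have X: "X \<in> obj C" using XY by (simp add: retract_of_def)
    have "retract_of C (sh C X) (sh C Y)" using XY X Y D retract_sh_iff by blast
    then have "sh C X \<in> sh C ` D" using r Y unfolding retraction_closed_def by blast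
    then show "X \<in> D" using D X sh_inject by blast
  qed
qed

text \<open>The membership conditions of the family intersected in \<open>envelope\<close>. A
  property holds on a whole envelope once it holds on the generators and cuts out such a
  class.\<close>

definition env_closed :: "'a set \<Rightarrow> bool" where
  "env_closed D \<longleftrightarrow> D \<subseteq> obj C \<and> extension_closed C D \<and> retraction_closed C D"

lemma env_closed_sh_iff: "D \<subseteq> obj C \<Longrightarrow> env_closed (sh C ` D) \<longleftrightarrow> env_closed D"
  using sh_obj by (auto simp: env_closed_def extension_closed_sh_iff retraction_closed_sh_iff)

lemma sh_image_vimage: "D \<subseteq> obj C \<Longrightarrow> sh C ` {X \<in> obj C. sh C X \<in> D} = D"
  using sh_surj by blast

text \<open>Preimages under translation allow minimality of an envelope to bound the translates of
  its objects.\<close>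

lemma env_closed_unsh: "env_closed D \<Longrightarrow> env_closed {X \<in> obj C. sh C X \<in> D}"
  using env_closed_sh_iff[of "{X \<in> obj C. sh C X \<in> D}"] sh_image_vimage[of D]
  by (auto simp: env_closed_def)

lemma env_closed_shift:
  assumes D: "env_closed D"
  shows "env_closed (shift C n ` D)"
proof -
  have sub: "D \<subseteq> obj C" using D by (simp add: env_closed_def)
  note iff = env_closed_sh_iff[OF shift_image_subset[OF sub]] and im = sh_image_shift[OF sub]
  show ?thesis
  proof (induction n rule: int_induct[where k = 0])
    case base
    show ?case using D by (simp add: shift_0)
  next
    case (step1 i)
    then show ?case using iff[of i] im[of i] by simp
  next
    case (step2 i)
    then show ?case using iff[of "i - 1"] im[of "i - 1"] by simp
  qed
qed

lemma env_closed_obj: "env_closed (obj C)"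
  using zobj_obj tri_obj
  by (auto simp: env_closed_def retraction_closed_def retract_of_def intro!: extension_closedI)

lemma envelope_least: "\<lbrakk>env_closed E; D \<subseteq> E\<rbrakk> \<Longrightarrow> envelope C D \<subseteq> E"
  by (auto simp: envelope_def env_closed_def)

lemma envelope_upper: "D \<subseteq> envelope C D"
  by (auto simp: envelope_def)

lemma env_closed_envelope:
  assumes "D \<subseteq> obj C"
  shows "env_closed (envelope C D)"
  unfolding env_closed_def
proof (intro conjI)
  show "envelope C D \<subseteq> obj C" by (rule envelope_least[OF env_closed_obj assms])
  show "extension_closed C (envelope C D)"
    unfolding envelope_def by (rule extension_closed_Inter) blast
  show "retraction_closed C (envelope C D)"
    unfolding envelope_def retraction_closed_def by blast
qed

section \<open>Extension-closures and triangulated subclasses\<close>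

lemma extension_closure_least:
  "\<lbrakk>extension_closed C E; E \<subseteq> obj C; D \<subseteq> E\<rbrakk> \<Longrightarrow> extension_closure C D \<subseteq> E"
  by (auto simp: extension_closure_def)

lemma extension_closure_upper: "D \<subseteq> extension_closure C D"
  by (auto simp: extension_closure_def)

lemma extension_closed_extension_closure: "extension_closed C (extension_closure C D)"
  unfolding extension_closure_def by (rule extension_closed_Inter) blast

lemma extension_closure_subset_obj: "D \<subseteq> obj C \<Longrightarrow> extension_closure C D \<subseteq> obj C"
  using env_closed_obj by (intro extension_closure_least) (auto simp: env_closed_def)

text \<open>Minimality is applied once to the image and once to the preimage of the closure under
  translation; each contains U.\<close>

lemma sh_extension_closure:
  assumes U: "U \<subseteq> obj C" and sU: "sh C ` U = U"
  shows "sh C ` extension_closure C U = extension_closure C U"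
proof
  let ?T = "extension_closure C U"
  have T: "?T \<subseteq> obj C" by (rule extension_closure_subset_obj[OF U])
  show "?T \<subseteq> sh C ` ?T"
  proof (rule extension_closure_least)
    show "extension_closed C (sh C ` ?T)"
      by (simp add: extension_closed_sh_iff[OF T] extension_closed_extension_closure)
    show "sh C ` ?T \<subseteq> obj C" using T sh_obj by auto
    show "U \<subseteq> sh C ` ?T" using sU extension_closure_upper[of U] by blast
  qed
  let ?T' = "{X \<in> obj C. sh C X \<in> ?T}"
  have "?T \<subseteq> ?T'"
  proof (rule extension_closure_least)
    show "extension_closed C ?T'"
      using extension_closed_sh_iff[of ?T'] sh_image_vimage[OF T] extension_closed_extension_closure[of U]
      by auto
    show "U \<subseteq> ?T'" using U sU extension_closure_upper[of U] by blast
  qed blast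
  then show "sh C ` ?T \<subseteq> ?T" by blast
qed

lemma triangulated_subclassI:
  assumes "T \<subseteq> obj C" "sh C ` T = T" "extension_closed C T"
  shows "triangulated_subclass C T"
  unfolding triangulated_subclass_def
proof (intro conjI allI impI)
  show "zobj C \<in> T" by (rule extension_closed_zobj[OF assms(3)])
  fix X Y Z f g h assume "dtriangle C X Y Z f g h \<and> X \<in> T \<and> Y \<in> T"
  \<comment> \<open>The cone of X -> Y is an extension of X[1] by Y.\<close>
  then show "Z \<in> T"
    using extension_closedD[OF assms(3) tri_rotate[OF triI]] assms(2) by blast
qed (use assms in auto)

lemma densely_generated_subset:
  assumes "densely_generated_by C D" "D \<subseteq> T" "triangulated_subclass C T" "retraction_closed C T"
  shows "obj C \<subseteq> T"
  using assms unfolding densely_generated_by_def by blast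

subsection \<open>Unions of shifts of a class stable under a shift\<close>

lemma shift_image_antimono:
  assumes D: "D \<subseteq> obj C" and sD: "sh C ` D \<subseteq> D" and "i \<le> j"
  shows "shift C j ` D \<subseteq> shift C i ` D"
  using \<open>i \<le> j\<close>
proof (induction j rule: int_ge_induct)
  case (step k)
  have "shift C (k + 1) ` D = shift C k ` sh C ` D" by (rule shift_image_sh[OF D, symmetric])
  also have "\<dots> \<subseteq> shift C k ` D" by (rule image_mono[OF sD])
  finally show ?case using step.IH by blast
qed simp

lemma shift_image_mono:
  assumes D: "D \<subseteq> obj C" and sD: "D \<subseteq> sh C ` D" and "i \<le> j"
  shows "shift C i ` D \<subseteq> shift C j ` D"
  using \<open>i \<le> j\<close>
proof (induction j rule: int_ge_induct)
  case (step k)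
  have "shift C k ` D \<subseteq> shift C k ` sh C ` D" by (rule image_mono[OF sD])
  also have "\<dots> = shift C (k + 1) ` D" by (rule shift_image_sh[OF D])
  finally show ?case using step.IH by blast
qed simp

lemma shift_image_chain:
  assumes "D \<subseteq> obj C" "sh C ` D \<subseteq> D \<or> D \<subseteq> sh C ` D"
  shows "shift C i ` D \<subseteq> shift C j ` D \<or> shift C j ` D \<subseteq> shift C i ` D"
  using shift_image_antimono[OF assms(1), of i j] shift_image_antimono[OF assms(1), of j i]
    shift_image_mono[OF assms(1), of i j] shift_image_mono[OF assms(1), of j i] assms(2)
  by (cases "i \<le> j") auto

lemma sh_union_shifts:
  assumes D: "D \<subseteq> obj C"
  shows "sh C ` (\<Union>i. shift C i ` D) = (\<Union>i. shift C i ` D)"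
proof -
  have "sh C ` (\<Union>i. shift C i ` D) = (\<Union>i. shift C (i + 1) ` D)"
    using sh_image_shift[OF D] by (simp add: image_UN)
  also have "\<dots> = (\<Union>i. shift C i ` D)"
  proof (intro equalityI subsetI)
    fix X assume "X \<in> (\<Union>i. shift C i ` D)"
    then obtain i where "X \<in> shift C ((i - 1) + 1) ` D" by auto
    then show "X \<in> (\<Union>i. shift C (i + 1) ` D)" by blast
  qed blast
  finally show ?thesis .
qed

text \<open>The shifts of D form a chain, so the two outer objects of a triangle already lie in a
  common shift.\<close>

lemma env_closed_union_shifts:
  assumes D: "env_closed D" and sD: "sh C ` D \<subseteq> D \<or> D \<subseteq> sh C ` D"
  shows "env_closed (\<Union>i. shift C i ` D)"
  unfolding env_closed_def
proof (intro conjI)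
  have sub: "D \<subseteq> obj C" using D by (simp add: env_closed_def)
  show "(\<Union>i. shift C i ` D) \<subseteq> obj C" using shift_image_subset[OF sub] by blast
  have closed: "extension_closed C (shift C i ` D)" "retraction_closed C (shift C i ` D)" for i
    using env_closed_shift[OF D] by (auto simp: env_closed_def)
  show "retraction_closed C (\<Union>i. shift C i ` D)"
    using closed(2) unfolding retraction_closed_def by blast
  show "extension_closed C (\<Union>i. shift C i ` D)"
  proof (rule extension_closedI)
    show "zobj C \<in> (\<Union>i. shift C i ` D)" using extension_closed_zobj[OF closed(1)] by blast
    fix A E B assume t: "tri A E B" and "A \<in> (\<Union>i. shift C i ` D)" "B \<in> (\<Union>i. shift C i ` D)"
    then obtain i j where "A \<in> shift C i ` D" "B \<in> shift C j ` D" by blast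
    then obtain k where "A \<in> shift C k ` D" "B \<in> shift C k ` D"
      using shift_image_chain[OF sub sD, of i j] by blast
    then show "E \<in> (\<Union>i. shift C i ` D)" using extension_closedD[OF closed(1) t] by blast
  qed
qed

lemma union_shifts_subset:
  assumes C0: "C0 \<subseteq> obj C" and bound: "\<forall>c \<in> C0. \<exists>i. shift C i c \<in> D"
  shows "(\<Union>i. shift C i ` C0) \<subseteq> (\<Union>i. shift C i ` D)"
proof
  fix X assume "X \<in> (\<Union>i. shift C i ` C0)"
  then obtain c j where c: "c \<in> C0" "X = shift C j c" by blast
  then obtain i where i: "shift C i c \<in> D" using bound by blast
  have "X = shift C (j - i) (shift C i c)"
    using shift_add[of c "j - i" i] c C0 by auto
  with i show "X \<in> (\<Union>i. shift C i ` D)" by blast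
qed

lemma subset_union_shifts: "D \<subseteq> (\<Union>i. shift C i ` D)"
proof
  fix X assume "X \<in> D"
  moreover have "X = shift C 0 X" by (simp add: shift_0)
  ultimately show "X \<in> (\<Union>i. shift C i ` D)" by blast
qed

text \<open>Boundedness on generators spreads to all objects: the union of the shifts of D is
  extension-closed and contains every shift of every generator.\<close>

lemma extension_generated_union_shifts:
  assumes D: "env_closed D" and sD: "sh C ` D \<subseteq> D \<or> D \<subseteq> sh C ` D"
    and gen: "extension_closure C (\<Union>i. shift C i ` C0) = obj C" and C0: "C0 \<subseteq> obj C"
    and bound: "\<forall>c \<in> C0. \<exists>i. shift C i c \<in> D"
  shows "obj C = (\<Union>i. shift C i ` D)"
proof
  note U = env_closed_union_shifts[OF D sD, unfolded env_closed_def]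
  show "(\<Union>i. shift C i ` D) \<subseteq> obj C" using U by blast
  show "obj C \<subseteq> (\<Union>i. shift C i ` D)"
    unfolding gen[symmetric]
    by (intro extension_closure_least union_shifts_subset C0 bound) (use U in blast)+
qed

text \<open>The union of all shifts is moreover stable under translation both ways, hence
  triangulated, and it is retraction-closed.\<close>

lemma densely_generated_union_shifts:
  assumes D: "env_closed D" and sD: "sh C ` D \<subseteq> D \<or> D \<subseteq> sh C ` D"
    and gen: "densely_generated_by C C0" and C0: "C0 \<subseteq> obj C"
    and bound: "\<forall>c \<in> C0. \<exists>i. shift C i c \<in> D"
  shows "obj C = (\<Union>i. shift C i ` D)"
proof
  have sub: "D \<subseteq> obj C" using D by (simp add: env_closed_def)
  note U = env_closed_union_shifts[OF D sD, unfolded env_closed_def]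
  show "(\<Union>i. shift C i ` D) \<subseteq> obj C" using U by blast
  show "obj C \<subseteq> (\<Union>i. shift C i ` D)"
  proof (rule densely_generated_subset[OF gen])
    show "C0 \<subseteq> (\<Union>i. shift C i ` D)"
      using subset_union_shifts union_shifts_subset[OF C0 bound] by (rule subset_trans)
    show "triangulated_subclass C (\<Union>i. shift C i ` D)"
      using U sh_union_shifts[OF sub] by (intro triangulated_subclassI) blast+
    show "retraction_closed C (\<Union>i. shift C i ` D)" using U by blast
  qed
qed

subsection \<open>Orthogonality\<close>

text \<open>A map from E that vanishes on A factors through B, and a map from a retract is
  determined by its composite with the retraction.\<close>

lemma env_closed_left_orthogonal:
  "env_closed {X \<in> obj C. \<forall>Y \<in> S. \<forall>f \<in> mor C X Y. f = mzero C X Y}" (is "env_closed ?D")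
  unfolding env_closed_def
proof (intro conjI)
  show "?D \<subseteq> obj C" by blast
  show "extension_closed C ?D"
  proof (rule extension_closedI)
    show "zobj C \<in> ?D" using zobj_obj zobj_initial mor_tgt by blast
    fix A E B assume t: "tri A E B" and A: "A \<in> ?D" and B: "B \<in> ?D"
    from t obtain u v w where d: "dtriangle C A E B u v w" by (rule triE)
    note T = dtriangleD[OF d]
    have "f = mzero C E Y" if Y: "Y \<in> S" and f: "f \<in> mor C E Y" for Y f
    proof -
      have "f \<cdot> u = mzero C A Y" using A Y comp_mor[OF T(1) f] by blast
      then obtain b where b: "b \<in> mor C B Y" "b \<cdot> v = f"
        using dtriangle_weak_cokernel[OF d f] by blast
      then show ?thesis using B Y mzero_comp[OF T(2) mor_tgt[OF f]] by auto
    qed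
    then show "E \<in> ?D" using T(5) by blast
  qed
  show "retraction_closed C ?D"
    unfolding retraction_closed_def
  proof (intro ballI allI impI)
    fix Z X assume Z: "Z \<in> ?D" and "retract_of C X Z"
    then obtain i p where ip: "i \<in> mor C X Z" "p \<in> mor C Z X" "p \<cdot> i = ident C X"
      by (auto simp: retract_of_def)
    have "f = mzero C X Y" if Y: "Y \<in> S" and f: "f \<in> mor C X Y" for Y f
    proof -
      have "f \<cdot> p = mzero C Z Y" using Z Y comp_mor[OF ip(2) f] by blast
      then have "mzero C Z Y \<cdot> i = f"
        using comp_assoc[OF ip(1,2) f] ip(3) comp_ident[OF f] by simp
      then show ?thesis using mzero_comp[OF ip(1) mor_tgt[OF f]] by simp
    qed
    then show "X \<in> ?D" using mor_src[OF ip(1)] by blast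
  qed
qed

text \<open>The dual argument: a map into E that vanishes in B lifts to A.\<close>

lemma env_closed_right_orthogonal:
  "env_closed {Y \<in> obj C. \<forall>X \<in> S. \<forall>f \<in> mor C X Y. f = mzero C X Y}" (is "env_closed ?D")
  unfolding env_closed_def
proof (intro conjI)
  show "?D \<subseteq> obj C" by blast
  show "extension_closed C ?D"
  proof (rule extension_closedI)
    show "zobj C \<in> ?D" using zobj_obj zobj_terminal mor_src by blast
    fix A E B assume t: "tri A E B" and A: "A \<in> ?D" and B: "B \<in> ?D"
    from t obtain u v w where d: "dtriangle C A E B u v w" by (rule triE)
    note T = dtriangleD[OF d]
    have "f = mzero C X E" if X: "X \<in> S" and f: "f \<in> mor C X E" for X f
    proof -
      have "v \<cdot> f = mzero C X B" using B X comp_mor[OF f T(2)] by blast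
      then obtain b where b: "b \<in> mor C X A" "u \<cdot> b = f"
        using dtriangle_weak_kernel[OF d f] by blast
      then show ?thesis using A X comp_mzero[OF T(1) mor_src[OF f]] by auto
    qed
    then show "E \<in> ?D" using T(5) by blast
  qed
  show "retraction_closed C ?D"
    unfolding retraction_closed_def
  proof (intro ballI allI impI)
    fix Z Y assume Z: "Z \<in> ?D" and "retract_of C Y Z"
    then obtain i p where ip: "i \<in> mor C Y Z" "p \<in> mor C Z Y" "p \<cdot> i = ident C Y"
      by (auto simp: retract_of_def)
    have "f = mzero C X Y" if X: "X \<in> S" and f: "f \<in> mor C X Y" for X f
    proof -
      have "i \<cdot> f = mzero C X Z" using Z X comp_mor[OF f ip(1)] by blast
      then have "p \<cdot> mzero C X Z = f"
        using comp_assoc[OF f ip(1,2)] ip(3) ident_comp[OF f] by simp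
      then show ?thesis using comp_mzero[OF ip(2) mor_src[OF f]] by simp
    qed
    then show "Y \<in> ?D" using mor_src[OF ip(1)] by blast
  qed
qed

section \<open>Dense triangulated subclasses\<close>

text \<open>Closure under cones is the substance: a cone of a map between retracts is a retract of a
  cone of a map inside T.\<close>

lemma triangulated_subclass_retracts:
  assumes T: "T \<subseteq> obj C" "sh C ` T = T" "extension_closed C T"
  shows "triangulated_subclass C {M. \<exists>N \<in> T. retract_of C M N}" (is "triangulated_subclass C ?R")
  unfolding triangulated_subclass_def
proof (intro conjI allI impI)
  show sub: "?R \<subseteq> obj C" by (auto simp: retract_of_def)
  show "zobj C \<in> ?R"
    using extension_closed_zobj[OF T(3)] retract_of_refl[OF zobj_obj] by blast
  show "sh C ` ?R = ?R"
  proof (intro equalityI subsetI)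
    fix X assume "X \<in> sh C ` ?R"
    then obtain M N where MN: "X = sh C M" "N \<in> T" "retract_of C M N" by blast
    then have "retract_of C X (sh C N)"
      using retract_sh_iff by (auto simp: retract_of_def[of C M])
    then show "X \<in> ?R" using MN T(2) by blast
  next
    fix X assume "X \<in> ?R"
    then obtain N where N: "N \<in> T" "retract_of C X N" by blast
    obtain N' where N': "N' \<in> T" "N = sh C N'" using N(1) T(2) by blast
    have "X \<in> obj C" using N(2) by (simp add: retract_of_def)
    then obtain X' where X': "X' \<in> obj C" "X = sh C X'" by (rule sh_surj)
    have "retract_of C X' N'" using N N' X' T(1) retract_sh_iff by blast
    then show "X \<in> sh C ` ?R" using N' X' by blast
  qed
  fix X Y Z f g h assume a: "dtriangle C X Y Z f g h \<and> X \<in> ?R \<and> Y \<in> ?R"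
  then obtain A B where AB: "A \<in> T" "B \<in> T" "retract_of C X A" "retract_of C Y B" by blast
  obtain f' g' h' W where W: "dtriangle C A B W f' g' h'" "retract_of C Z W"
    using retract_of_cone[OF conjunct1[OF a] AB(3,4)] .
  have "sh C A \<in> T" using AB(1) T(2) by blast
  then have "W \<in> T" by (rule extension_closedD[OF T(3) tri_rotate[OF triI[OF W(1)]] AB(2)])
  with W(2) show "Z \<in> ?R" by blast
qed

lemma densely_generated_retract:
  assumes dg: "densely_generated_by C D" and T: "T \<subseteq> obj C" "sh C ` T = T" "extension_closed C T"
    and DT: "D \<subseteq> T" and M: "M \<in> obj C"
  obtains N where "N \<in> T" "retract_of C M N"
proof -
  let ?R = "{M. \<exists>N \<in> T. retract_of C M N}"
  have "retraction_closed C ?R"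
    using retract_of_trans unfolding retraction_closed_def by blast
  moreover have "D \<subseteq> ?R" using DT T(1) retract_of_refl by blast
  ultimately have "obj C \<subseteq> ?R"
    using densely_generated_subset[OF dg] triangulated_subclass_retracts[OF T] by blast
  with M that show thesis by blast
qed

text \<open>Each step replaces M by its complement M' in N, again a retract of N, which is why M is
  generalized in the induction. If S' -> M' -> K' approximates M', then M -> M'[1] -> K'[1]
  approximates M with K' moved up by one translation.\<close>

lemma retract_approximation:
  assumes T: "T \<subseteq> obj C" "sh C ` T = T" "extension_closed C T"
    and N: "N \<in> T" "N \<in> D" and D: "D \<subseteq> obj C" "retraction_closed C D"
    and M: "retract_of C M N"
  shows "\<exists>S \<in> T. \<exists>K \<in> shift C (int n + 1) ` D. tri S M K"
  using M
proof (induction n arbitrary: M)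
  case 0
  obtain M' where M': "tri M' N M" "retract_of C M' N" using retract_complement[OF 0] .
  have "M' \<in> D" using D(2) N(2) M'(2) by (auto simp: retraction_closed_def)
  then have "sh C M' \<in> shift C (int 0 + 1) ` D" by (simp add: shift_1)
  then show ?case using N(1) tri_rotate[OF M'(1)] by blast
next
  case (Suc n)
  obtain M' where M': "tri M' N M" "retract_of C M' N" using retract_complement[OF Suc.prems] .
  obtain S' K' where SK: "S' \<in> T" "K' \<in> shift C (int n + 1) ` D" "tri S' M' K'"
    using Suc.IH[OF M'(2)] by blast
  obtain a b c where t1: "dtriangle C M (sh C M') (sh C N) a b c"
    using tri_rotate[OF tri_rotate[OF M'(1)]] by (rule triE)
  have "tri (sh C M') (sh C K') (sh C (sh C S'))"
    using SK(3) by (intro tri_rotate)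
  then obtain p q r where t2: "dtriangle C (sh C M') (sh C K') (sh C (sh C S')) p q r"
    by (rule triE)
  have "p \<cdot> a \<in> mor C M (sh C K')"
    by (rule comp_mor[OF dtriangleD(1)[OF t1] dtriangleD(1)[OF t2]])
  then obtain W k l where t3: "dtriangle C M (sh C K') W (p \<cdot> a) k l" using TR1_cone by blast
  obtain S where S: "S \<in> obj C" "W = sh C S" using sh_surj[OF dtriangleD(6)[OF t3]] .
  \<comment> \<open>The octahedron makes S an extension of S'[1] by N, so S stays in T.\<close>
  have "tri (sh C N) (sh C S) (sh C (sh C S'))"
    using octahedron[OF t1 t2 t3] S(2) by simp
  then have "tri N S (sh C S')"
    using tri_shift_iff S(1) T(1) N(1) SK(1) sh_obj by blast
  then have "S \<in> T" using extension_closedD[OF T(3)] N(1) SK(1) T(2) by blast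
  moreover have "tri S M (sh C K')"
    using tri_unrotate[OF triI[OF t3[unfolded S(2)]] S(1)] .
  moreover have "sh C K' \<in> shift C (int (Suc n) + 1) ` D"
    using SK(2) sh_image_shift[OF D(1), of "int n + 1"] by (auto simp: algebra_simps)
  ultimately show ?case by blast
qed

end

section \<open>Pre-weight decompositions\<close>

locale pre_weight = triangulated_cat C
  for C :: "('o, 'm) tricat" (structure) +
  fixes Cm Cp :: "'o set"
  assumes Cm_obj: "Cm \<subseteq> obj C" and Cp_obj: "Cp \<subseteq> obj C"
    and Cm_sh: "Cm \<subseteq> sh C ` Cm" and Cp_sh: "sh C ` Cp \<subseteq> Cp"
    and Cm_Cp_orth: "orthogonal C Cm (sh C ` Cp)"
begin

abbreviation "L \<equiv> envelope C Cm"
abbreviation "R \<equiv> envelope C Cp"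

lemma L_closed: "env_closed L" and R_closed: "env_closed R"
  using env_closed_envelope Cm_obj Cp_obj by auto

lemma L_obj: "L \<subseteq> obj C" and R_obj: "R \<subseteq> obj C"
  and L_ext: "extension_closed C L" and R_ext: "extension_closed C R"
  and L_retr: "retraction_closed C L" and R_retr: "retraction_closed C R"
  using L_closed R_closed by (simp_all add: env_closed_def)

lemma L_sh: "L \<subseteq> sh C ` L"
  using Cm_sh envelope_upper[of Cm] L_closed env_closed_sh_iff[OF L_obj]
  by (intro envelope_least) blast+

text \<open>Here minimality is applied to the preimage of R under translation, whereas for L the
  image is the closed class.\<close>

lemma R_sh: "sh C ` R \<subseteq> R"
proof -
  have "Cp \<subseteq> {X \<in> obj C. sh C X \<in> R}"
    using Cp_sh Cp_obj envelope_upper[of Cp] by blast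
  from envelope_least[OF env_closed_unsh[OF R_closed] this] show ?thesis by blast
qed

text \<open>Minimality is used twice: first L is bounded by the left orthogonal of the translated
  \<open>Cp\<close>, then R by the objects whose translation is right orthogonal to all of
  L.\<close>

lemma L_R_orth:
  assumes "X \<in> L" "Y \<in> R" "f \<in> mor C X (sh C Y)"
  shows "f = mzero C X (sh C Y)"
proof -
  let ?A = "{X \<in> obj C. \<forall>Y \<in> sh C ` Cp. \<forall>f \<in> mor C X Y. f = mzero C X Y}"
  have "Cm \<subseteq> ?A" using Cm_Cp_orth Cm_obj unfolding orthogonal_def by blast
  then have LA: "L \<subseteq> ?A" by (rule envelope_least[OF env_closed_left_orthogonal])
  let ?B = "{Y \<in> obj C. \<forall>X \<in> L. \<forall>f \<in> mor C X Y. f = mzero C X Y}"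
  have "Cp \<subseteq> {Y \<in> obj C. sh C Y \<in> ?B}" using LA Cp_obj sh_obj by blast
  then have "R \<subseteq> {Y \<in> obj C. sh C Y \<in> ?B}"
    by (rule envelope_least[OF env_closed_unsh[OF env_closed_right_orthogonal]])
  then show ?thesis using assms by blast
qed

lemma has_pwd_iff: "has_pre_weight_decomp C Cm Cp M \<longleftrightarrow> (\<exists>X \<in> L. \<exists>Y \<in> R. tri X M (sh C Y))"
  unfolding has_pre_weight_decomp_def pre_weight_decomp_def extension_of_def shift_1 by blast

lemma tri_pwd:
  assumes "tri X M (sh C Y)" "X \<in> L" "Y \<in> R"
  shows "\<exists>f g h. pre_weight_decomp C Cm Cp M X Y f g h"
  using assms unfolding pre_weight_decomp_def extension_of_def shift_1 by blast

lemma pwdD: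
  assumes "pre_weight_decomp C Cm Cp M X Y f g h"
  shows "dtriangle C X M (sh C Y) f g h" "X \<in> L" "Y \<in> R"
  using assms by (auto simp: pre_weight_decomp_def shift_1)

text \<open>\<open>E1\<close> is the pullback of the extension \<open>E\<close> along \<open>XM \<rightarrow> M\<close>. By orthogonality its class
  \<open>XM \<rightarrow> N[1]\<close> comes from a class \<open>XM \<rightarrow> XN[1]\<close>, which defines \<open>X\<close>.\<close>

lemma extension_decomposition:
  assumes M: "tri XM M (sh C YM)" "XM \<in> L"
    and N: "tri XN N (sh C YN)" "YN \<in> R"
    and E: "tri N E M" and YM: "YM \<in> obj C"
  shows "\<exists>X Y. tri X E (sh C Y) \<and> tri XN X XM \<and> tri YN Y YM"
proof -
  \<comment> \<open>The obstruction met below lands in YN[2]; orthogonality applies to it because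
    YN[1] is again in R.\<close>
  have YN: "YN \<in> obj C" "sh C YN \<in> R" using N(2) R_obj R_sh by auto
  obtain a a1 a2 where tM: "dtriangle C XM M (sh C YM) a a1 a2" using M(1) by (rule triE)
  obtain d d1 d2 where tE: "dtriangle C M (sh C N) (sh C E) d d1 d2"
    using tri_rotate[OF tri_rotate[OF E]] by (rule triE)
  obtain b b1 b2 where tN: "dtriangle C (sh C XN) (sh C N) (sh C (sh C YN)) b b1 b2"
    using tri_rotate[OF tri_rotate[OF tri_rotate[OF N(1)]]] by (rule triE)
  note TM = dtriangleD[OF tM] and TE = dtriangleD[OF tE] and TN = dtriangleD[OF tN]
  have c: "d \<cdot> a \<in> mor C XM (sh C N)" by (rule comp_mor[OF TM(1) TE(1)])
  obtain W w1 w2 where tW: "dtriangle C XM (sh C N) W (d \<cdot> a) w1 w2" using TR1_cone[OF c] by blast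
  obtain E1 where E1: "E1 \<in> obj C" "W = sh C E1" using sh_surj[OF dtriangleD(6)[OF tW]] .
  \<comment> \<open>First octahedron, on XM -> M -> N[1]: the cone of E1 -> E is YM[1].\<close>
  have "tri (sh C YM) (sh C E1) (sh C E)" using octahedron[OF tM tE tW] E1 by simp
  then have tri1: "tri E1 E (sh C YM)"
    using tri_unrotate tri_unrotate[of "sh C YM"] E1(1) tri_obj(2)[OF E] by blast
  have "b1 \<cdot> (d \<cdot> a) = mzero C XM (sh C (sh C YN))"
    by (rule L_R_orth[OF M(2) YN(2) comp_mor[OF c TN(2)]])
  then obtain e where e: "e \<in> mor C XM (sh C XN)" "b \<cdot> e = d \<cdot> a"
    using dtriangle_weak_kernel[OF tN c] by blast
  obtain V v1 v2 where tV: "dtriangle C XM (sh C XN) V e v1 v2" using TR1_cone[OF e(1)] by blast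
  obtain X where X: "X \<in> obj C" "V = sh C X" using sh_surj[OF dtriangleD(6)[OF tV]] .
  have XN: "XN \<in> obj C" using tri_obj(1)[OF N(1)] .
  have "tri XM (sh C XN) (sh C X)" using triI[OF tV] X(2) by simp
  then have triX: "tri XN X XM" using tri_unrotate X(1) XN by blast
  \<comment> \<open>Second octahedron, on XM -> XN[1] -> N[1]. Its composite is again d a, so the
    same E1 occurs.\<close>
  have "tri (sh C X) (sh C E1) (sh C (sh C YN))"
    using octahedron[OF tV tN tW[folded e(2)]] X E1 by simp
  then have "tri X E1 (sh C YN)" using tri_shift_iff X(1) E1(1) sh_obj[OF YN(1)] by blast
  then obtain p p1 p2 where t1: "dtriangle C X E1 (sh C YN) p p1 p2" by (rule triE)
  obtain q q1 q2 where t2: "dtriangle C E1 E (sh C YM) q q1 q2" using tri1 by (rule triE)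
  \<comment> \<open>Third octahedron, on X -> E1 -> E: its cone is an extension of YM[1] by
    YN[1].\<close>
  have "q \<cdot> p \<in> mor C X E" by (rule comp_mor[OF dtriangleD(1)[OF t1] dtriangleD(1)[OF t2]])
  then obtain Z z1 z2 where tZ: "dtriangle C X E Z (q \<cdot> p) z1 z2" using TR1_cone by blast
  obtain Y where Y: "Y \<in> obj C" "Z = sh C Y" using sh_surj[OF dtriangleD(6)[OF tZ]] .
  have "tri (sh C YN) (sh C Y) (sh C YM)" using octahedron[OF t1 t2 tZ] Y by simp
  then have "tri YN Y YM" using tri_shift_iff Y(1) YN(1) YM by blast
  moreover have "tri X E (sh C Y)" using triI[OF tZ] Y(2) by simp
  ultimately show ?thesis using triX by blast
qed

lemma pwd_extension:
  assumes M: "pre_weight_decomp C Cm Cp M XM YM fM gM hM"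
    and N: "pre_weight_decomp C Cm Cp N XN YN fN gN hN"
    and E: "extension_of C E M N"
  shows "\<exists>X Y f g h. pre_weight_decomp C Cm Cp E X Y f g h \<and>
    extension_of C X XM XN \<and> extension_of C Y YM YN"
proof -
  note M = pwdD[OF M] and N = pwdD[OF N]
  obtain X Y where XY: "tri X E (sh C Y)" "tri XN X XM" "tri YN Y YM"
    using extension_decomposition[OF triI[OF M(1)] M(2) triI[OF N(1)] N(3) E] M(3) R_obj by blast
  have "X \<in> L" by (rule extension_closedD[OF L_ext XY(2) N(2) M(2)])
  moreover have "Y \<in> R" by (rule extension_closedD[OF R_ext XY(3) N(3) M(3)])
  ultimately show ?thesis using tri_pwd[OF XY(1)] XY(2,3) by blast
qed

lemma pwd_extension_closed: "extension_closed C {M \<in> obj C. has_pre_weight_decomp C Cm Cp M}"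
proof (rule extension_closedI)
  \<comment> \<open>The right component of a decomposition of zero must translate exactly to
    \<open>zobj C\<close>; extension-closedness of the translated class supplies it.\<close>
  have "zobj C \<in> sh C ` R"
    using R_ext extension_closed_sh_iff[OF R_obj] extension_closed_zobj by blast
  then obtain Y where Y: "Y \<in> R" "sh C Y = zobj C" by auto
  have "tri (zobj C) (zobj C) (sh C Y)" using triI[OF TR1_ident[OF zobj_obj]] Y by simp
  then have "has_pre_weight_decomp C Cm Cp (zobj C)"
    unfolding has_pwd_iff using extension_closed_zobj[OF L_ext] Y(1) by blast
  then show "zobj C \<in> {M \<in> obj C. has_pre_weight_decomp C Cm Cp M}" using zobj_obj by simp
  fix A E B
  assume t: "tri A E B"
    and AB: "A \<in> {M \<in> obj C. has_pre_weight_decomp C Cm Cp M}"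
      "B \<in> {M \<in> obj C. has_pre_weight_decomp C Cm Cp M}"
  have "has_pre_weight_decomp C Cm Cp E"
    using pwd_extension[OF _ _ t] AB unfolding has_pre_weight_decomp_def by blast
  then show "E \<in> {M \<in> obj C. has_pre_weight_decomp C Cm Cp M}" using tri_obj(2)[OF t] by simp
qed

section \<open>From decompositions of generators to weight structures\<close>

lemma weight_structureI:
  assumes "\<And>M. M \<in> obj C \<Longrightarrow> has_pre_weight_decomp C Cm Cp M"
  shows "weight_structure C L R"
  unfolding weight_structure_def shift_1
proof (intro conjI)
  show "orthogonal C L (sh C ` R)" unfolding orthogonal_def using L_R_orth by blast
  show "\<forall>M \<in> obj C. \<exists>X Y f g h. dtriangle C X M Y f g h \<and> X \<in> L \<and> Y \<in> sh C ` R"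
  proof
    fix M assume "M \<in> obj C"
    then obtain X Y where XY: "X \<in> L" "Y \<in> R" "tri X M (sh C Y)"
      using assms has_pwd_iff by blast
    obtain f g h where "dtriangle C X M (sh C Y) f g h" using XY(3) by (rule triE)
    then show "\<exists>X Y f g h. dtriangle C X M Y f g h \<and> X \<in> L \<and> Y \<in> sh C ` R"
      using XY(1,2) by blast
  qed
qed (fact L_obj R_obj L_retr R_retr L_sh R_sh)+

lemma extension_generated_pwd:
  assumes "extension_closure C C' = obj C" "C' \<subseteq> obj C"
    and "\<forall>c \<in> C'. has_pre_weight_decomp C Cm Cp c" and "M \<in> obj C"
  shows "has_pre_weight_decomp C Cm Cp M"
  using extension_closure_least[OF pwd_extension_closed, of C'] assms by blast

lemma densely_generated_pwd:
  assumes gen: "densely_generated_by C C0" and C0: "C0 \<subseteq> obj C"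
    and pwd: "\<forall>c \<in> C0. \<forall>i. has_pre_weight_decomp C Cm Cp (shift C i c)"
    and bound: "\<forall>c \<in> C0. \<exists>i. shift C i c \<in> R"
    and M: "M \<in> obj C"
  shows "has_pre_weight_decomp C Cm Cp M"
proof -
  let ?U = "\<Union>i. shift C i ` C0"
  have U: "?U \<subseteq> obj C" using shift_image_subset[OF C0] by blast
  define T where "T = extension_closure C ?U"
  have T: "T \<subseteq> obj C" "sh C ` T = T" "extension_closed C T"
    unfolding T_def
    using extension_closure_subset_obj[OF U] sh_extension_closure[OF U sh_union_shifts[OF C0]]
      extension_closed_extension_closure by blast+
  have T_pwd: "T \<subseteq> {M \<in> obj C. has_pre_weight_decomp C Cm Cp M}"
    unfolding T_def using U pwd by (intro extension_closure_least pwd_extension_closed) blast+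
  have "C0 \<subseteq> T"
    unfolding T_def using subset_union_shifts extension_closure_upper by (rule subset_trans)
  then obtain N where N: "N \<in> T" "retract_of C M N"
    using densely_generated_retract[OF gen T _ M] by blast
  have "N \<in> (\<Union>i. shift C i ` R)"
    using subsetD[OF T(1) N(1)]
    unfolding densely_generated_union_shifts[OF R_closed disjI1[OF R_sh] gen C0 bound] .
  then obtain i where i: "N \<in> shift C i ` R" by blast
  have Ri: "shift C i ` R \<subseteq> obj C" "retraction_closed C (shift C i ` R)"
    using env_closed_shift[OF R_closed] by (auto simp: env_closed_def)
  \<comment> \<open>With N in R[i], taking n = nat (- i) puts K in a shift of R of index n + 1 + i
    \<ge> 1, hence in R[1].\<close>
  obtain S K where SK: "S \<in> T" "K \<in> shift C (int (nat (- i)) + 1) ` shift C i ` R" "tri S M K"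
    using retract_approximation[OF T N(1) i Ri N(2), of "nat (- i)"] by (elim bexE)
  have "K \<in> shift C (int (nat (- i)) + 1 + i) ` R" using SK(2) shift_shift_image[OF R_obj] by simp
  then have "K \<in> shift C 1 ` R"
    by (rule subsetD[OF shift_image_antimono[OF R_obj R_sh], rotated]) simp
  then obtain K' where K': "K' \<in> R" "K = sh C K'" by (auto simp: shift_1)
  obtain X Y where XY: "X \<in> L" "Y \<in> R" "tri X S (sh C Y)"
    using T_pwd SK(1) has_pwd_iff by blast
  obtain f f1 f2 where t1: "dtriangle C X S (sh C Y) f f1 f2" using XY(3) by (rule triE)
  obtain g g1 g2 where t2: "dtriangle C S M K g g1 g2" using SK(3) by (rule triE)
  have "g \<cdot> f \<in> mor C X M" by (rule comp_mor[OF dtriangleD(1)[OF t1] dtriangleD(1)[OF t2]])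
  then obtain Z k l where t3: "dtriangle C X M Z (g \<cdot> f) k l" using TR1_cone by blast
  \<comment> \<open>The cone of X -> S -> M is an extension of K by Y[1], both in R[1].\<close>
  have "tri (sh C Y) Z (sh C K')" using octahedron[OF t1 t2 t3] K'(2) by simp
  then have "Z \<in> sh C ` R"
    using extension_closedD[of "sh C ` R"] extension_closed_sh_iff[OF R_obj] R_ext XY(2) K'(1) by blast
  then show ?thesis unfolding has_pwd_iff using XY(1) triI[OF t3] by blast
qed

section \<open>Retracts and the components of decompositions\<close>

lemma retract_of_left_component:
  assumes N: "N \<in> L" and NM: "retract_of C N M" and M: "pre_weight_decomp C Cm Cp M X Y f g h"
  shows "retract_of C N X"
proof -
  note D = pwdD[OF M] and T = dtriangleD[OF pwdD(1)[OF M]]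
  obtain i p where ip: "i \<in> mor C N M" "p \<in> mor C M N" "p \<cdot> i = ident C N"
    using NM by (auto simp: retract_of_def)
  \<comment> \<open>Orthogonality kills N -> M -> Y[1], so the inclusion of N lifts to X.\<close>
  have "g \<cdot> i = mzero C N (sh C Y)" by (rule L_R_orth[OF N D(3) comp_mor[OF ip(1) T(2)]])
  then obtain j where j: "j \<in> mor C N X" "f \<cdot> j = i" using dtriangle_weak_kernel[OF D(1) ip(1)] by blast
  have "(p \<cdot> f) \<cdot> j = ident C N" using comp_assoc[OF j(1) T(1) ip(2)] j(2) ip(3) by simp
  then show ?thesis by (rule retract_of_factor[OF j(1) comp_mor[OF T(1) ip(2)]])
qed

text \<open>Dually, the retraction M[1] -> N[1] vanishes on A and therefore factors through B[1];
  the conclusion is then desuspended.\<close>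

lemma retract_of_right_component:
  assumes N: "N \<in> R" and NM: "retract_of C N M"
    and M: "pre_weight_decomp C Cm Cp (sh C M) A B f g h"
  shows "retract_of C N B"
proof -
  note D = pwdD[OF M] and T = dtriangleD[OF pwdD(1)[OF M]]
  have "M \<in> obj C" using NM by (simp add: retract_of_def)
  then have "retract_of C (sh C N) (sh C M)" using NM N R_obj retract_sh_iff by blast
  then obtain i p where ip: "i \<in> mor C (sh C N) (sh C M)" "p \<in> mor C (sh C M) (sh C N)"
      "p \<cdot> i = ident C (sh C N)"
    by (auto simp: retract_of_def)
  have "p \<cdot> f = mzero C A (sh C N)" by (rule L_R_orth[OF D(2) N comp_mor[OF T(1) ip(2)]])
  then obtain q where q: "q \<in> mor C (sh C B) (sh C N)" "q \<cdot> g = p"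
    using dtriangle_weak_cokernel[OF D(1) ip(2)] by blast
  have "q \<cdot> (g \<cdot> i) = ident C (sh C N)" using comp_assoc[OF ip(1) T(2) q(1)] q(2) ip(3) by simp
  then have "retract_of C (sh C N) (sh C B)"
    by (rule retract_of_factor[OF comp_mor[OF ip(1) T(2)] q(1)])
  then show ?thesis using retract_sh_iff N D(3) R_obj by blast
qed

text \<open>Rotating A -> X[1] -> B[1] exhibits B as an extension of A by X, both of which lie in
  L.\<close>

lemma right_component_in_heart:
  assumes X: "X \<in> L" and M: "pre_weight_decomp C Cm Cp (sh C X) A B f g h"
  shows "B \<in> L \<inter> R"
proof -
  note D = pwdD[OF M]
  have "tri (sh C X) (sh C B) (sh C A)" using tri_rotate[OF triI[OF D(1)]] .
  then have "tri X B A" using tri_shift_iff X D(2,3) L_obj R_obj by blast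
  then show ?thesis using extension_closedD[OF L_ext] X D(2,3) by blast
qed

end

theorem theorem2p1p1:
  fixes C :: "('o, 'm) tricat" and Cm Cp :: "'o set"
  assumes "triangulated_cat C"
    and "Cm \<subseteq> obj C" and "Cp \<subseteq> obj C"
    and "Cm \<subseteq> shift C 1 ` Cm"
    and "shift C 1 ` Cp \<subseteq> Cp"
    and "orthogonal C Cm (shift C 1 ` Cp)"
  shows
    \<comment> \<open>I.1\<close>
    "(extension_closed C {M \<in> obj C. has_pre_weight_decomp C Cm Cp M} \<and>
      (\<forall>M N E XM YM fM gM hM XN YN fN gN hN.
         pre_weight_decomp C Cm Cp M XM YM fM gM hM \<and>
         pre_weight_decomp C Cm Cp N XN YN fN gN hN \<and>
         extension_of C E M N \<longrightarrow>
         (\<exists>X Y f g h. pre_weight_decomp C Cm Cp E X Y f g h \<and>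
            extension_of C X XM XN \<and> extension_of C Y YM YN))) \<and>
     \<comment> \<open>I.2\<close>
     (envelope C Cm \<subseteq> shift C 1 ` envelope C Cm \<and>
      shift C 1 ` envelope C Cp \<subseteq> envelope C Cp) \<and>
     \<comment> \<open>I.3\<close>
     orthogonal C (envelope C Cm) (shift C 1 ` envelope C Cp) \<and>
     \<comment> \<open>I.4\<close>
     (\<forall>C'. C' \<subseteq> obj C \<and> extension_closure C C' = obj C \<and>
        (\<forall>c \<in> C'. has_pre_weight_decomp C Cm Cp c) \<longrightarrow>
        weight_structure C (envelope C Cm) (envelope C Cp)) \<and>
     \<comment> \<open>I.5\<close>
     (\<forall>C' C0. C' \<subseteq> obj C \<and> extension_closure C C' = obj C \<and>
        (\<forall>c \<in> C'. has_pre_weight_decomp C Cm Cp c) \<and>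
        C0 \<subseteq> obj C \<and> C' = (\<Union>i. shift C i ` C0) \<longrightarrow>
        ((\<forall>c \<in> C0. \<exists>i. shift C i c \<in> envelope C Cp) \<longrightarrow>
           bounded_below C (envelope C Cm) (envelope C Cp)) \<and>
        ((\<forall>c \<in> C0. \<exists>i. shift C i c \<in> envelope C Cm) \<longrightarrow>
           bounded_above C (envelope C Cm) (envelope C Cp))) \<and>
     \<comment> \<open>II\<close>
     (\<forall>C''. C'' \<subseteq> obj C \<and> densely_generated_by C C'' \<and>
        (\<forall>c \<in> C''. \<forall>i. has_pre_weight_decomp C Cm Cp (shift C i c)) \<and>
        (\<forall>c \<in> C''. \<exists>i. shift C i c \<in> envelope C Cp) \<longrightarrow>
        weight_structure C (envelope C Cm) (envelope C Cp) \<and>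
        bounded_below C (envelope C Cm) (envelope C Cp) \<and>
        ((\<forall>c \<in> C''. \<exists>i. shift C i c \<in> envelope C Cm) \<longrightarrow>
           bounded_above C (envelope C Cm) (envelope C Cp))) \<and>
     \<comment> \<open>III\<close>
     (\<forall>N M X Y f g h.
        N \<in> envelope C Cm \<and> M \<in> obj C \<and> retract_of C N M \<and>
        pre_weight_decomp C Cm Cp M X Y f g h \<longrightarrow>
        \<comment> \<open>III.1\<close>
        retract_of C N X \<and>
        \<comment> \<open>III.2\<close>
        (\<forall>N' M' A' B' f' g' h'.
           N' \<in> envelope C Cp \<and> M' \<in> obj C \<and> retract_of C N' M' \<and>
           pre_weight_decomp C Cm Cp (shift C 1 M') A' B' f' g' h' \<longrightarrow>
           retract_of C N' B') \<and>
        \<comment> \<open>III.3\<close>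
        (\<forall>A B f' g' h'.
           pre_weight_decomp C Cm Cp (shift C 1 X) A B f' g' h' \<longrightarrow>
           B \<in> envelope C Cm \<inter> envelope C Cp \<and>
           (N \<in> envelope C Cp \<longrightarrow> retract_of C N B)))"
proof -
  interpret triangulated_cat C by fact
  interpret pre_weight C Cm Cp
    using assms(2-) by unfold_locales (simp_all add: shift_1)
  show ?thesis
  proof (intro conjI)
    show "extension_closed C {M \<in> obj C. has_pre_weight_decomp C Cm Cp M}"
      by (rule pwd_extension_closed)
    show "\<forall>M N E XM YM fM gM hM XN YN fN gN hN.
         pre_weight_decomp C Cm Cp M XM YM fM gM hM \<and>
         pre_weight_decomp C Cm Cp N XN YN fN gN hN \<and>
         extension_of C E M N \<longrightarrow>
         (\<exists>X Y f g h. pre_weight_decomp C Cm Cp E X Y f g h \<and>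
            extension_of C X XM XN \<and> extension_of C Y YM YN)"
      by (intro allI impI, elim conjE) (rule pwd_extension)
    show "L \<subseteq> shift C 1 ` L" "shift C 1 ` R \<subseteq> R"
      unfolding shift_1 by (rule L_sh, rule R_sh)
    show "orthogonal C L (shift C 1 ` R)"
      unfolding orthogonal_def shift_1 using L_R_orth by blast
    show "\<forall>C'. C' \<subseteq> obj C \<and> extension_closure C C' = obj C \<and>
        (\<forall>c \<in> C'. has_pre_weight_decomp C Cm Cp c) \<longrightarrow> weight_structure C L R"
      using extension_generated_pwd weight_structureI by blast
    show "\<forall>C' C0. C' \<subseteq> obj C \<and> extension_closure C C' = obj C \<and>
        (\<forall>c \<in> C'. has_pre_weight_decomp C Cm Cp c) \<and>
        C0 \<subseteq> obj C \<and> C' = (\<Union>i. shift C i ` C0) \<longrightarrow>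
        ((\<forall>c \<in> C0. \<exists>i. shift C i c \<in> R) \<longrightarrow> bounded_below C L R) \<and>
        ((\<forall>c \<in> C0. \<exists>i. shift C i c \<in> L) \<longrightarrow> bounded_above C L R)"
      unfolding bounded_below_def bounded_above_def
    proof (intro allI impI, elim conjE, intro conjI impI)
      fix C' C0
      assume "extension_closure C C' = obj C" "C' = (\<Union>i. shift C i ` C0)" and C0: "C0 \<subseteq> obj C"
      then have gen: "extension_closure C (\<Union>i. shift C i ` C0) = obj C" by simp
      \<comment> \<open>The shifts of R decrease and those of L increase; either monotonicity gives
        the chain needed for the union.\<close>
      show "obj C = (\<Union>i. shift C i ` R)" if "\<forall>c \<in> C0. \<exists>i. shift C i c \<in> R"
        by (rule extension_generated_union_shifts[OF R_closed disjI1[OF R_sh] gen C0 that])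
      show "obj C = (\<Union>i. shift C i ` L)" if "\<forall>c \<in> C0. \<exists>i. shift C i c \<in> L"
        by (rule extension_generated_union_shifts[OF L_closed disjI2[OF L_sh] gen C0 that])
    qed
    show "\<forall>C''. C'' \<subseteq> obj C \<and> densely_generated_by C C'' \<and>
        (\<forall>c \<in> C''. \<forall>i. has_pre_weight_decomp C Cm Cp (shift C i c)) \<and>
        (\<forall>c \<in> C''. \<exists>i. shift C i c \<in> R) \<longrightarrow>
        weight_structure C L R \<and> bounded_below C L R \<and>
        ((\<forall>c \<in> C''. \<exists>i. shift C i c \<in> L) \<longrightarrow> bounded_above C L R)"
    proof (intro allI impI, elim conjE, intro conjI impI)
      fix C0
      assume C0: "C0 \<subseteq> obj C" and gen: "densely_generated_by C C0"
        and pwd: "\<forall>c \<in> C0. \<forall>i. has_pre_weight_decomp C Cm Cp (shift C i c)"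
        and bR: "\<forall>c \<in> C0. \<exists>i. shift C i c \<in> R"
      show "weight_structure C L R"
        by (rule weight_structureI, rule densely_generated_pwd[OF gen C0 pwd bR])
      show "bounded_below C L R"
        unfolding bounded_below_def
        by (rule densely_generated_union_shifts[OF R_closed disjI1[OF R_sh] gen C0 bR])
      assume bL: "\<forall>c \<in> C0. \<exists>i. shift C i c \<in> L"
      show "bounded_above C L R"
        unfolding bounded_above_def
        by (rule densely_generated_union_shifts[OF L_closed disjI2[OF L_sh] gen C0 bL])
    qed
    show "\<forall>N M X Y f g h.
        N \<in> L \<and> M \<in> obj C \<and> retract_of C N M \<and> pre_weight_decomp C Cm Cp M X Y f g h \<longrightarrow>
        retract_of C N X \<and>
        (\<forall>N' M' A' B' f' g' h'.
           N' \<in> R \<and> M' \<in> obj C \<and> retract_of C N' M' \<and>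
           pre_weight_decomp C Cm Cp (shift C 1 M') A' B' f' g' h' \<longrightarrow> retract_of C N' B') \<and>
        (\<forall>A B f' g' h'.
           pre_weight_decomp C Cm Cp (shift C 1 X) A B f' g' h' \<longrightarrow>
           B \<in> L \<inter> R \<and> (N \<in> R \<longrightarrow> retract_of C N B))"
      unfolding shift_1
    proof (intro allI impI, elim conjE, intro conjI allI impI)
      fix N M X Y f g h
      assume N: "N \<in> L" "retract_of C N M" and M: "pre_weight_decomp C Cm Cp M X Y f g h"
      show NX: "retract_of C N X" by (rule retract_of_left_component[OF N M])
      show "retract_of C N' B'"
        if "N' \<in> R \<and> M' \<in> obj C \<and> retract_of C N' M' \<and>
           pre_weight_decomp C Cm Cp (sh C M') A' B' f' g' h'" for N' M' A' B' f' g' h'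
        using that by (blast intro: retract_of_right_component)
      fix A B f' g' h' assume X: "pre_weight_decomp C Cm Cp (sh C X) A B f' g' h'"
      show "B \<in> L \<inter> R" by (rule right_component_in_heart[OF pwdD(2)[OF M] X])
      \<comment> \<open>By \<open>NX\<close>, X itself can serve as the ambient object of N in the
        statement on right components.\<close>
      show "retract_of C N B" if "N \<in> R" by (rule retract_of_right_component[OF that NX X])
    qed
  qed
qed

end
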